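(* Let $G$ be a finitely generated group with a proper action $G \curvearrowright X$ by isometries on a proper geodesic metric space $X$. Let $H \le G$ be a finitely generated subgroup such that for some $x \in X$, the orbit map $\mathrm{orb}_x \colon G \to X$, $g \mapsto gx$, restricts to a stable embedding on $H$ (where $H$ carries a word metric with respect to a finite generating set). Then $H$ is stable in $G$.
   Context: A metric space $X$ is proper if closed balls are compact; an action $G\curvearrowright X$ is proper if for each compact $K\subset X$ the set $\{g\in G : gK\cap K\neq\emptyset\}$ is finite. For $\kappa\ge 1$, $\lambda\ge 0$, a $(\kappa,\lambda)$-quasi-isometric embedding $\phi\colon X\to Y$ is a map with $\frac1\kappa d_X(a,b)-\lambda\le d_Y(\phi(a),\phi(b))\le \kappa d_X(a,b)+\lambda$ for all $a,b\in X$. A $(\kappa,\lambda)$-quasigeodesic in $Y$ is a $(\kappa,\lambda)$-quasi-isometric embedding of an interval into $Y$; a $\kappa$-quasigeodesic is a $(\kappa,\kappa)$-quasigeodesic. Two subsets are $D$-Hausdorff close if each is contained in the $D$-neighborhood of the other. Stability: an undistorted (i.e. quasi-isometrically embedded) subspace $Y$ of a metric space $X$ is stable in $X$ if for any $\kappa>1$ there exists $D>0$ such that if $q,q'$ are $\kappa$-quasigeodesics in $X$ with the same endpoints $a,b\in Y$, then (the images of) $q$ and $q'$ are $D$-Hausdorff close. A stable embedding of $Y$ into $X$ is a quasi-isometric embedding $\phi\colon Y\to X$ whose image $\phi(Y)$ is stable in $X$. A finitely generated subgroup $H$ of a finitely generated group $G$ is stable in $G$ if the inclusion $H\to G$ is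 a quasi-isometric embedding for word metrics on $H$ and $G$ (i.e. $H$ is undistorted), and $H$ is a stable subspace of $G$, with $G$ regarded as (the vertex set of) its Cayley graph with respect to a finite generating set. This does not depend on the finite generating sets. *)

theory Defs
  imports "HOL-Analysis.Analysis" "HOL-Algebra.Generated_Groups" "HOL-Algebra.Group_Action"
begin

section \<open>Proper and geodesic metric spaces, proper isometric actions\<close>

definition proper_space :: "'x::metric_space itself \<Rightarrow> bool" where
  "proper_space _ \<longleftrightarrow> (\<forall>(x::'x) r. compact (cball x r))"

definition geodesic_space :: "'x::metric_space itself \<Rightarrow> bool" where
  "geodesic_space _ \<longleftrightarrow>
     (\<forall>(a::'x) b. \<exists>\<gamma> :: real \<Rightarrow> 'x. \<gamma> 0 = a \<and> \<gamma> (dist a b) = b \<and>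
        (\<forall>s\<in>{0..dist a b}. \<forall>t\<in>{0..dist a b}. dist (\<gamma> s) (\<gamma> t) = \<bar>s - t\<bar>))"

definition isometric_action ::
  "('g, 'r) monoid_scheme \<Rightarrow> ('g \<Rightarrow> 'x::metric_space \<Rightarrow> 'x) \<Rightarrow> bool" where
  "isometric_action G \<phi> \<longleftrightarrow>
     group_action G UNIV \<phi> \<and> (\<forall>g\<in>carrier G. \<forall>p q. dist (\<phi> g p) (\<phi> g q) = dist p q)"

definition proper_action ::
  "('g, 'r) monoid_scheme \<Rightarrow> ('g \<Rightarrow> 'x::metric_space \<Rightarrow> 'x) \<Rightarrow> bool" where
  "proper_action G \<phi> \<longleftrightarrow>
     (\<forall>K. compact K \<longrightarrow> finite {g \<in> carrier G. \<phi> g ` K \<inter> K \<noteq> {}})"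

section \<open>Quasi-isometric embeddings and stability\<close>

text \<open>Metric spaces appear here as pairs of a carrier set and a distance function, because the
  notions are applied to a metric space type, to intervals, and to groups with word metrics.\<close>

definition qi_embedding_with ::
  "real \<Rightarrow> real \<Rightarrow> 'a set \<Rightarrow> ('a \<Rightarrow> 'a \<Rightarrow> real) \<Rightarrow> 'b set \<Rightarrow> ('b \<Rightarrow> 'b \<Rightarrow> real) \<Rightarrow> ('a \<Rightarrow> 'b) \<Rightarrow> bool" where
  "qi_embedding_with \<kappa> l A dA B dB f \<longleftrightarrow>
     \<kappa> \<ge> 1 \<and> l \<ge> 0 \<and> f ` A \<subseteq> B \<and>
     (\<forall>a\<in>A. \<forall>b\<in>A. 1 / \<kappa> * dA a b - l \<le> dB (f a) (f b) \<and> dB (f a) (f b) \<le> \<kappa> * dA a b + l)"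

definition qi_embedding ::
  "'a set \<Rightarrow> ('a \<Rightarrow> 'a \<Rightarrow> real) \<Rightarrow> 'b set \<Rightarrow> ('b \<Rightarrow> 'b \<Rightarrow> real) \<Rightarrow> ('a \<Rightarrow> 'b) \<Rightarrow> bool" where
  "qi_embedding A dA B dB f \<longleftrightarrow> (\<exists>\<kappa> l. qi_embedding_with \<kappa> l A dA B dB f)"

text \<open>A \<open>\<kappa>\<close>-quasigeodesic from \<open>a\<close> to \<open>b\<close>, parametrised by the interval \<open>{s..t}\<close>;
  no continuity is required.\<close>

definition quasigeodesic ::
  "real \<Rightarrow> 'b set \<Rightarrow> ('b \<Rightarrow> 'b \<Rightarrow> real) \<Rightarrow> (real \<Rightarrow> 'b) \<Rightarrow> real \<Rightarrow> real \<Rightarrow> 'b \<Rightarrow> 'b \<Rightarrow> bool" where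
  "quasigeodesic \<kappa> X d q s t a b \<longleftrightarrow>
     s \<le> t \<and> qi_embedding_with \<kappa> \<kappa> {s..t} dist X d q \<and> q s = a \<and> q t = b"

definition hausdorff_close :: "('b \<Rightarrow> 'b \<Rightarrow> real) \<Rightarrow> real \<Rightarrow> 'b set \<Rightarrow> 'b set \<Rightarrow> bool" where
  "hausdorff_close d D A B \<longleftrightarrow>
     (\<forall>a\<in>A. \<exists>b\<in>B. d a b \<le> D) \<and> (\<forall>b\<in>B. \<exists>a\<in>A. d b a \<le> D)"

text \<open>The subspace \<open>Y\<close> carries its own metric \<open>dY\<close>, so that being undistorted is meaningful for a
  subgroup with its word metric; for \<open>dY = dX\<close> that conjunct amounts to \<open>Y \<subseteq> X\<close>.\<close>

definition stable_subspace ::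
  "'b set \<Rightarrow> ('b \<Rightarrow> 'b \<Rightarrow> real) \<Rightarrow> 'b set \<Rightarrow> ('b \<Rightarrow> 'b \<Rightarrow> real) \<Rightarrow> bool" where
  "stable_subspace Y dY X dX \<longleftrightarrow>
     qi_embedding Y dY X dX (\<lambda>y. y) \<and>
     (\<forall>\<kappa>>1. \<exists>D>0. \<forall>a\<in>Y. \<forall>b\<in>Y. \<forall>q s t q' s' t'.
        quasigeodesic \<kappa> X dX q s t a b \<longrightarrow> quasigeodesic \<kappa> X dX q' s' t' a b \<longrightarrow>
        hausdorff_close dX D (q ` {s..t}) (q' ` {s'..t'}))"

definition stable_embedding ::
  "'a set \<Rightarrow> ('a \<Rightarrow> 'a \<Rightarrow> real) \<Rightarrow> 'b set \<Rightarrow> ('b \<Rightarrow> 'b \<Rightarrow> real) \<Rightarrow> ('a \<Rightarrow> 'b) \<Rightarrow> bool" where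
  "stable_embedding Y dY X dX f \<longleftrightarrow>
     qi_embedding Y dY X dX f \<and> stable_subspace (f ` Y) dX X dX"

section \<open>Word metrics and stable subgroups\<close>

definition finite_generating_set :: "('g, 'r) monoid_scheme \<Rightarrow> 'g set \<Rightarrow> 'g set \<Rightarrow> bool" where
  "finite_generating_set G H S \<longleftrightarrow> finite S \<and> S \<subseteq> H \<and> generate G S = H"

definition word_length :: "('g, 'r) monoid_scheme \<Rightarrow> 'g set \<Rightarrow> 'g \<Rightarrow> nat" where
  "word_length G S g =
     (LEAST n. \<exists>ws. length ws = n \<and> set ws \<subseteq> S \<union> m_inv G ` S \<and> foldr (mult G) ws \<one>\<^bsub>G\<^esub> = g)"

text \<open>The graph distance in the Cayley graph with edges \<open>{g, g s}\<close>. It is a metric on the subgroup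
  generated by \<open>S\<close>; only its values there are meaningful. Since words in a subset of a subgroup
  \<open>H\<close> stay in \<open>H\<close>, the word metric of \<open>H\<close> can be computed with the operations of \<open>G\<close>.\<close>

definition word_dist :: "('g, 'r) monoid_scheme \<Rightarrow> 'g set \<Rightarrow> 'g \<Rightarrow> 'g \<Rightarrow> real" where
  "word_dist G S g h = real (word_length G S (inv\<^bsub>G\<^esub> g \<otimes>\<^bsub>G\<^esub> h))"

text \<open>Stability does not depend on the generating sets; the definition asks for it for all of
  them, and asks that some exist.\<close>

definition stable_subgroup :: "('g, 'r) monoid_scheme \<Rightarrow> 'g set \<Rightarrow> bool" where
  "stable_subgroup G H \<longleftrightarrow>
     subgroup H G \<and>
     (\<exists>S. finite_generating_set G (carrier G) S) \<and> (\<exists>T. finite_generating_set G H T) \<and>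
     (\<forall>S T. finite_generating_set G (carrier G) S \<longrightarrow> finite_generating_set G H T \<longrightarrow>
        stable_subspace H (word_dist G T) (carrier G) (word_dist G S))"

end

theory Submission
  imports Defs
begin

text \<open>A stable subspace \<open>Y\<close> of a geodesic space \<open>X\<close> is sublinearly contracting: were nearest points
  in \<open>Y\<close> of two points at distance about \<open>r\<close> from \<open>Y\<close> and at most \<open>r / 4\<close> apart to lie more than
  \<open>\<epsilon> r\<close> apart, then the two perpendiculars joined by a well-chosen geodesic would form a quasigeodesic
  with endpoints in \<open>Y\<close> that leaves every fixed neighbourhood of \<open>Y\<close> once \<open>r\<close> is large.

  Let \<open>q\<close> be a quasigeodesic of \<open>G\<close> with endpoints in \<open>H\<close>. On a stretch of length \<open>n\<close> where the orbit path
  \<open>q x\<close> is far from \<open>Y = H x\<close>, its projection to \<open>Y\<close> moves by at most \<open>\<epsilon> n + const\<close>. The stretch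
  starts and ends at bounded distance from \<open>Y\<close> in \<open>X\<close>, hence, by properness of the action, from \<open>H\<close>
  in \<open>G\<close>, and \<open>H\<close> is undistorted; for small \<open>\<epsilon>\<close> this bounds \<open>n\<close>. So \<open>q\<close> stays near \<open>H\<close>, and pushing it
  into \<open>H\<close> gives a quasigeodesic whose orbit path is a quasigeodesic of \<open>X\<close> between points of \<open>Y\<close>,
  to which stability in \<open>X\<close> applies.\<close>

section \<open>Stable subspaces are contracting\<close>

definition geodesic_on :: "(real \<Rightarrow> 'x::metric_space) \<Rightarrow> real \<Rightarrow> bool" where
  "geodesic_on \<gamma> l \<longleftrightarrow> 0 \<le> l \<and> (\<forall>s\<in>{0..l}. \<forall>t\<in>{0..l}. dist (\<gamma> s) (\<gamma> t) = \<bar>s - t\<bar>)"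

lemma geodesic_on_dist:
  "geodesic_on \<gamma> l \<Longrightarrow> 0 \<le> s \<Longrightarrow> s \<le> l \<Longrightarrow> 0 \<le> t \<Longrightarrow> t \<le> l \<Longrightarrow> dist (\<gamma> s) (\<gamma> t) = \<bar>s - t\<bar>"
  by (simp add: geodesic_on_def)

lemma geodesic_on_subset: "geodesic_on \<gamma> l \<Longrightarrow> 0 \<le> m \<Longrightarrow> m \<le> l \<Longrightarrow> geodesic_on \<gamma> m"
  by (simp add: geodesic_on_def)

lemma geodesic_on_reverse: "geodesic_on \<gamma> l \<Longrightarrow> geodesic_on (\<lambda>s. \<gamma> (l - s)) l"
  by (auto simp: geodesic_on_def)

lemma geodesic_on_continuous:
  assumes "geodesic_on \<gamma> l"
  shows "continuous_on {0..l} \<gamma>"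
  unfolding continuous_on_iff
proof (intro ballI allI impI)
  fix s e :: real assume "s \<in> {0..l}" "0 < e"
  then show "\<exists>d>0. \<forall>t\<in>{0..l}. dist t s < d \<longrightarrow> dist (\<gamma> t) (\<gamma> s) < e"
    using assms by (intro exI[of _ e]) (auto simp: geodesic_on_def dist_real_def)
qed

lemma geodesic_spaceE:
  assumes "geodesic_space TYPE('x::metric_space)"
  obtains \<gamma> where "geodesic_on \<gamma> (dist a b)" "\<gamma> 0 = (a::'x)" "\<gamma> (dist a b) = b"
  using assms unfolding geodesic_space_def geodesic_on_def by (metis zero_le_dist)

lemma quasigeodesic_mono:
  assumes "quasigeodesic k X d q s t a b" "k \<le> k'" "\<And>x y. x \<in> X \<Longrightarrow> y \<in> X \<Longrightarrow> 0 \<le> d x y"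
  shows "quasigeodesic k' X d q s t a b"
proof -
  have k: "1 \<le> k" using assms(1) by (simp add: quasigeodesic_def qi_embedding_with_def)
  have "1 / k' * \<bar>u - v\<bar> - k' \<le> 1 / k * \<bar>u - v\<bar> - k" for u v :: real
    using k assms(2) by (intro diff_mono mult_right_mono) (auto simp: frac_le)
  moreover have "k * \<bar>u - v\<bar> + k \<le> k' * \<bar>u - v\<bar> + k'" for u v :: real
    using assms(2) by (intro add_mono mult_right_mono) auto
  ultimately show ?thesis
    using assms(1,2) unfolding quasigeodesic_def qi_embedding_with_def dist_real_def
    by (smt (verit, ccfv_SIG))
qed

text \<open>Put x = \<open>dist p (\<beta> m)\<close> and c = \<open>dist p (\<beta> 0)\<close>.
  Going from \<open>p\<close> to \<open>\<beta> l\<close> through \<open>\<beta> m\<close> turns the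
  last hypothesis into m \<le> x + c / 2. Together with c \<le> x + m this gives c \<le> 4 x and m
  \<le> 3 x, so 10 leaves room. The left side is the length of the path from \<open>p\<close> to
  \<open>\<beta> m\<close> that turns at the corner \<open>\<beta> 0\<close>.\<close>

lemma geodesic_corner:
  fixes p :: "'x::metric_space"
  assumes "geodesic_on \<beta> l" "0 \<le> m" "m \<le> l" "l \<le> dist p (\<beta> l) + dist p (\<beta> 0) / 2"
  shows "dist p (\<beta> 0) + m \<le> 10 * dist p (\<beta> m)"
proof -
  have "dist (\<beta> m) (\<beta> 0) = m" "dist (\<beta> m) (\<beta> l) = l - m"
    using assms by (auto simp: geodesic_on_def)
  moreover have "dist p (\<beta> 0) \<le> dist p (\<beta> m) + dist (\<beta> m) (\<beta> 0)"
    "dist p (\<beta> l) \<le> dist p (\<beta> m) + dist (\<beta> m) (\<beta> l)"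
    by (rule dist_triangle)+
  ultimately show ?thesis using assms(2-4) zero_le_dist[of p "\<beta> m"] by argo
qed

text \<open>The concatenation has unit speed, so only the lower bound on distances needs work.
  Across a single corner it is \<open>geodesic_corner\<close>, whose hypothesis comes from
  \<open>left\<close> or \<open>right\<close>; \<open>sep\<close> handles two points on different
  outer pieces.\<close>

lemma quasigeodesic_three_segments:
  fixes \<alpha> \<beta> \<delta> :: "real \<Rightarrow> 'x::metric_space"
  assumes geo: "geodesic_on \<alpha> a" "geodesic_on \<beta> l" "geodesic_on \<delta> b"
    and ends: "\<beta> 0 = \<alpha> a" "\<beta> l = \<delta> b"
    and k: "10 \<le> k"
    and left: "\<And>s. s \<in> {0..a} \<Longrightarrow> l \<le> dist (\<alpha> s) (\<delta> b) + (a - s) / 2"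
    and right: "\<And>t. t \<in> {0..b} \<Longrightarrow> l \<le> dist (\<alpha> a) (\<delta> t) + (b - t) / 2"
    and sep: "\<And>s t. s \<in> {0..a} \<Longrightarrow> t \<in> {0..b} \<Longrightarrow> a + l + b \<le> k * dist (\<alpha> s) (\<delta> t)"
  obtains w where "quasigeodesic k UNIV dist w 0 (a + l + b) (\<alpha> 0) (\<delta> 0)"
    and "\<alpha> a \<in> w ` {0..a + l + b}" and "\<delta> b \<in> w ` {0..a + l + b}"
proof
  \<comment> \<open>\<open>\<delta>\<close> is run backwards, so that in the application both
    perpendiculars are parametrised from their feet.\<close>
  define w where "w = (\<lambda>u. if u \<le> a then \<alpha> u else if u \<le> a + l then \<beta> (u - a) else \<delta> (a + l + b - u))"
  have nn: "0 \<le> a" "0 \<le> l" "0 \<le> b" using geo by (auto simp: geodesic_on_def)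
  have main: "dist (w u) (w v) \<le> v - u \<and> v - u \<le> k * dist (w u) (w v)"
    if uv: "0 \<le> u" "u \<le> v" "v \<le> a + l + b" for u v
  proof -
    have same: "d \<le> v - u \<and> v - u \<le> k * d" if "d = v - u" for d
      using uv k that mult_right_mono[of 1 k d] by auto
    have corner: "c \<le> k * d" if "c \<le> 10 * d" "0 \<le> d" for c d
      using that k mult_right_mono[of 10 k d] by auto
    consider "v \<le> a" | "u \<le> a" "a < v" "v \<le> a + l" | "u \<le> a" "a + l < v"
      | "a < u" "v \<le> a + l" | "a < u" "u \<le> a + l" "a + l < v" | "a + l < u"
      using uv nn by linarith
    then show ?thesis
    proof cases
      case 1
      then have "dist (w u) (w v) = v - u"
        using uv geo(1) by (simp add: w_def geodesic_on_dist)
      then show ?thesis by (rule same)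
    next
      case 2
      have w: "w u = \<alpha> u" "w v = \<beta> (v - a)" using 2 by (auto simp: w_def)
      have e: "dist (\<alpha> u) (\<beta> 0) = a - u"
        using 2 uv nn geo(1) ends by (simp add: geodesic_on_dist)
      have "dist (\<beta> 0) (\<beta> (v - a)) = v - a"
        using 2 uv nn geo(2) by (simp add: geodesic_on_dist)
      then have "dist (w u) (w v) \<le> v - u"
        using dist_triangle[of "\<alpha> u" "\<beta> (v - a)" "\<beta> 0"] e w by simp
      moreover have "dist (\<alpha> u) (\<beta> 0) + (v - a) \<le> 10 * dist (\<alpha> u) (\<beta> (v - a))"
        using 2 uv geo(2) left[of u] e ends by (intro geodesic_corner[where l = l]) auto
      ultimately show ?thesis using corner e w by simp
    next
      case 3
      have w: "w u = \<alpha> u" "w v = \<delta> (a + l + b - v)" using 3 nn by (auto simp: w_def)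
      have "dist (\<alpha> u) (\<alpha> a) = a - u" "dist (\<beta> 0) (\<beta> l) = l"
        "dist (\<delta> b) (\<delta> (a + l + b - v)) = v - a - l"
        using 3 uv nn geo by (auto simp: geodesic_on_dist)
      then have "dist (w u) (w v) \<le> v - u"
        using dist_triangle[of "\<alpha> u" "\<delta> (a + l + b - v)" "\<alpha> a"]
          dist_triangle[of "\<alpha> a" "\<delta> (a + l + b - v)" "\<delta> b"] ends w by simp
      moreover have "a + l + b \<le> k * dist (w u) (w v)"
        unfolding w using 3 uv nn by (intro sep) auto
      ultimately show ?thesis using uv by simp
    next
      case 4
      then have "dist (w u) (w v) = v - u"
        using uv geo(2) by (simp add: w_def geodesic_on_dist)
      then show ?thesis by (rule same)
    next
      case 5
      have w: "w u = \<beta> (u - a)" "w v = \<delta> (a + l + b - v)" using 5 nn by (auto simp: w_def)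
      have e: "dist (\<delta> (a + l + b - v)) (\<delta> b) = v - a - l"
        using 5 uv nn geo(3) by (simp add: geodesic_on_dist)
      have "dist (\<beta> (u - a)) (\<beta> l) = l + a - u"
        using 5 uv nn geo(2) by (simp add: geodesic_on_dist)
      then have "dist (w u) (w v) \<le> v - u"
        using dist_triangle[of "\<beta> (u - a)" "\<delta> (a + l + b - v)" "\<delta> b"] e w ends
        by (simp add: dist_commute)
      \<comment> \<open>The second corner is the first one read backwards:
        \<open>geodesic_corner\<close> is applied to the reverse of \<open>\<beta>\<close> at
        parameter \<open>a + l - u\<close>.\<close>
      moreover have "l \<le> dist (\<delta> (a + l + b - v)) (\<alpha> a) + dist (\<delta> (a + l + b - v)) (\<delta> b) / 2"
        using right[of "a + l + b - v"] 5 uv unfolding e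
        by (simp add: dist_commute diff_divide_distrib add_divide_distrib)
      then have "dist (\<delta> (a + l + b - v)) (\<beta> (l - 0)) + (a + l - u)
          \<le> 10 * dist (\<delta> (a + l + b - v)) (\<beta> (l - (a + l - u)))"
        using 5 ends geodesic_on_reverse[OF geo(2)]
        by (intro geodesic_corner[where l = l and \<beta> = "\<lambda>s. \<beta> (l - s)"]) auto
      ultimately show ?thesis using corner e w ends by (simp add: dist_commute)
    next
      case 6
      then have "dist (w u) (w v) = v - u"
        using uv geo(3) nn by (simp add: w_def geodesic_on_dist)
      then show ?thesis by (rule same)
    qed
  qed
  have sym: "dist (w u) (w v) \<le> \<bar>u - v\<bar> \<and> \<bar>u - v\<bar> \<le> k * dist (w u) (w v)"
    if "u \<in> {0..a + l + b}" "v \<in> {0..a + l + b}" for u v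
    using main[of u v] main[of v u] that by (cases "u \<le> v") (auto simp: dist_commute)
  have "1 / k * dist u v - k \<le> dist (w u) (w v) \<and> dist (w u) (w v) \<le> k * dist u v + k"
    if "u \<in> {0..a + l + b}" "v \<in> {0..a + l + b}" for u v
  proof -
    have "1 / k * \<bar>u - v\<bar> \<le> dist (w u) (w v)"
      using sym[OF that] k by (simp add: field_simps)
    moreover have "\<bar>u - v\<bar> \<le> k * \<bar>u - v\<bar>"
      using k mult_right_mono[of 1 k "\<bar>u - v\<bar>"] by simp
    ultimately show ?thesis using sym[OF that] k unfolding dist_real_def by linarith
  qed
  moreover have w0: "w 0 = \<alpha> 0" using nn by (simp add: w_def)
  \<comment> \<open>If \<open>l = 0\<close> or \<open>b = 0\<close>, the junction falls into an
    earlier branch of \<open>w\<close>; \<open>ends\<close> makes the values agree.\<close>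
  moreover have wal: "w (a + l) = \<delta> b"
    using nn ends by (cases "l = 0") (auto simp: w_def)
  moreover have "w (a + l + b) = \<delta> 0"
    using nn wal by (cases "b = 0") (auto simp: w_def)
  ultimately show "quasigeodesic k UNIV dist w 0 (a + l + b) (\<alpha> 0) (\<delta> 0)"
    using nn k by (auto simp: quasigeodesic_def qi_embedding_with_def)
  have "w a = \<alpha> a" by (simp add: w_def)
  then show "\<alpha> a \<in> w ` {0..a + l + b}" using nn by (metis add.assoc add_increasing2 add_nonneg_nonneg atLeastAtMost_iff imageI order_refl)
  show "\<delta> b \<in> w ` {0..a + l + b}" using nn wal by (metis add_increasing2 add_nonneg_nonneg atLeastAtMost_iff imageI order_refl)
qed

text \<open>The perpendiculars are cut at points \<open>\<alpha> a\<close>, \<open>\<delta> b\<close> before being joined. If they come within \<open>h r\<close> of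
  each other, the lowest such pair is taken: it lies within \<open>D\<close> of \<open>Y\<close>, which bounds \<open>dist y1 y2\<close>.
  Otherwise the pair minimises the distance plus half the descent from \<open>x1\<close>, \<open>x2\<close>; the penalty
  keeps it at height at least \<open>r / 2\<close>, which is impossible.\<close>

lemma stable_subspace_contracting:
  fixes Y :: "'x::metric_space set"
  assumes X: "geodesic_space TYPE('x)"
    and Y: "stable_subspace Y dY UNIV dist"
    and conn: "\<And>a b. a \<in> Y \<Longrightarrow> b \<in> Y \<Longrightarrow>
      \<exists>q s t. quasigeodesic k0 UNIV dist q s t a b \<and> q ` {s..t} \<subseteq> Y"
    and e: "0 < e"
  obtains R where "0 < R"
    and "\<And>x1 x2 y1 y2. y1 \<in> Y \<Longrightarrow> y2 \<in> Y \<Longrightarrow>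
      (\<And>y. y \<in> Y \<Longrightarrow> dist x1 y1 \<le> dist x1 y) \<Longrightarrow> (\<And>y. y \<in> Y \<Longrightarrow> dist x2 y2 \<le> dist x2 y) \<Longrightarrow>
      R \<le> dist x1 y1 \<Longrightarrow> dist x1 x2 \<le> dist x1 y1 / 4 \<Longrightarrow> dist y1 y2 \<le> e * dist x1 y1"
proof -
  \<comment> \<open>\<open>h\<close> separates the two cases below; \<open>h \<le> e / 2\<close>
    leaves half of e r for the descent along the perpendiculars. In \<open>k\<close>, the entry
    \<open>4 / h\<close> compares the length of the path, at most 4 r, with the separation h r of
    its outer pieces; 10 serves the corners, and \<open>k0\<close> the paths from
    \<open>conn\<close>.\<close>
  define h where "h = min 1 (e / 2)"
  define k where "k = max k0 (max 10 (4 / h))"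
  have h: "0 < h" "h \<le> 1" "h \<le> e / 2" using e by (auto simp: h_def)
  have k: "k0 \<le> k" "10 \<le> k" "4 / h \<le> k" by (auto simp: k_def)
  have k4: "4 \<le> k * h" using k(3) h by (simp add: field_simps)
  have "k > 1" using k by simp
  then obtain D where D: "0 < D" and
    D': "\<And>a b q s t q' s' t'. a \<in> Y \<Longrightarrow> b \<in> Y \<Longrightarrow> quasigeodesic k UNIV dist q s t a b \<Longrightarrow>
      quasigeodesic k UNIV dist q' s' t' a b \<Longrightarrow> hausdorff_close dist D (q ` {s..t}) (q' ` {s'..t'})"
    using Y unfolding stable_subspace_def by meson
  \<comment> \<open>Stability only compares two quasigeodesics; the one inside \<open>Y\<close>
    given by \<open>conn\<close> turns this into closeness to \<open>Y\<close>.\<close>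
  have near: "\<exists>y\<in>Y. dist p y \<le> D"
    if q: "quasigeodesic k UNIV dist q s t a b" "a \<in> Y" "b \<in> Y" "p \<in> q ` {s..t}" for q s t a b p
  proof -
    obtain q' s' t' where q': "quasigeodesic k0 UNIV dist q' s' t' a b" "q' ` {s'..t'} \<subseteq> Y"
      using conn[OF q(2,3)] by blast
    have "quasigeodesic k UNIV dist q' s' t' a b"
      using quasigeodesic_mono[OF q'(1) k(1)] by simp
    then have "hausdorff_close dist D (q ` {s..t}) (q' ` {s'..t'})"
      using D'[OF q(2,3) q(1)] by simp
    then show ?thesis using q(4) q'(2) unfolding hausdorff_close_def by blast
  qed
  \<comment> \<open>The first entry excludes r / 2 \<le> D, the second absorbs 2 D into e r /
    2.\<close>
  define R where "R = max (2 * D + 1) (4 * D / e)"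
  have R: "0 < R" "2 * D < R" "4 * D \<le> e * R"
  proof -
    have "4 * D / e \<le> R" "2 * D + 1 \<le> R" by (auto simp: R_def)
    then show "0 < R" "2 * D < R" "4 * D \<le> e * R" using D e by (auto simp: field_simps)
  qed
  have "dist y1 y2 \<le> e * dist x1 y1"
    if y: "y1 \<in> Y" "y2 \<in> Y" and n1: "\<And>y. y \<in> Y \<Longrightarrow> dist x1 y1 \<le> dist x1 y"
      and n2: "\<And>y. y \<in> Y \<Longrightarrow> dist x2 y2 \<le> dist x2 y"
      and far: "R \<le> dist x1 y1" and x: "dist x1 x2 \<le> dist x1 y1 / 4" for x1 x2 y1 y2
  proof -
    define r r' where "r = dist y1 x1" and "r' = dist y2 x2"
    have "r' \<le> dist x2 y1" using n2[OF y(1)] by (simp add: r'_def dist_commute)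
    then have r: "R \<le> r" "0 \<le> r'" "r' \<le> 5 / 4 * r" "dist x1 x2 \<le> r / 4"
      using far x dist_triangle2[of x2 y1 x1] unfolding r_def r'_def by (auto simp: dist_commute)
    have r0: "0 < r" using r R by simp
    obtain \<alpha> where \<alpha>: "geodesic_on \<alpha> r" "\<alpha> 0 = y1" "\<alpha> r = x1"
      using geodesic_spaceE[OF X] unfolding r_def by metis
    obtain \<delta> where \<delta>: "geodesic_on \<delta> r'" "\<delta> 0 = y2" "\<delta> r' = x2"
      using geodesic_spaceE[OF X] unfolding r'_def by metis
    \<comment> \<open>The foot of a perpendicular stays a nearest point all along it, so the
      parameter is a lower bound for the distance to \<open>Y\<close>.\<close>
    have proj1: "s \<le> dist (\<alpha> s) z" if "s \<in> {0..r}" "z \<in> Y" for s z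
    proof -
      have "dist x1 (\<alpha> s) = r - s" using that \<alpha> r0 geodesic_on_dist[OF \<alpha>(1), of r s] by auto
      then show ?thesis
        using n1[OF that(2)] dist_triangle[of x1 z "\<alpha> s"] by (simp add: r_def dist_commute)
    qed
    have proj2: "s \<le> dist (\<delta> s) z" if "s \<in> {0..r'}" "z \<in> Y" for s z
    proof -
      have "dist x2 (\<delta> s) = r' - s" using that \<delta> r geodesic_on_dist[OF \<delta>(1), of r' s] by auto
      then show ?thesis
        using n2[OF that(2)] dist_triangle[of x2 z "\<delta> s"] by (simp add: r'_def dist_commute)
    qed
    \<comment> \<open>The three-segment path through \<open>\<alpha> a\<close> and
      \<open>\<delta> b\<close> is a quasigeodesic from \<open>y1\<close> to \<open>y2\<close>, so
      both corners are within \<open>D\<close> of \<open>Y\<close>; by \<open>proj1\<close> and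
      \<open>proj2\<close> their heights are then at most \<open>D\<close>.\<close>
    have low: "a \<le> D \<and> b \<le> D"
      if ab: "a \<in> {0..r}" "b \<in> {0..r'}" and l: "dist (\<alpha> a) (\<delta> b) \<le> r"
        and left: "\<And>s. s \<in> {0..a} \<Longrightarrow> dist (\<alpha> a) (\<delta> b) \<le> dist (\<alpha> s) (\<delta> b) + (a - s) / 2"
        and right: "\<And>t. t \<in> {0..b} \<Longrightarrow> dist (\<alpha> a) (\<delta> b) \<le> dist (\<alpha> a) (\<delta> t) + (b - t) / 2"
        and sep: "\<And>s t. s \<in> {0..a} \<Longrightarrow> t \<in> {0..b} \<Longrightarrow> h * r \<le> dist (\<alpha> s) (\<delta> t)" for a b
    proof -
      define l where "l = dist (\<alpha> a) (\<delta> b)"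
      obtain \<beta> where \<beta>: "geodesic_on \<beta> l" "\<beta> 0 = \<alpha> a" "\<beta> l = \<delta> b"
        using geodesic_spaceE[OF X] unfolding l_def by metis
      have sep': "a + l + b \<le> k * dist (\<alpha> s) (\<delta> t)" if "s \<in> {0..a}" "t \<in> {0..b}" for s t
      proof -
        have "a + l + b \<le> 4 * r" using ab l r unfolding l_def by auto
        also have "\<dots> \<le> k * h * r" using k4 r0 by simp
        also have "\<dots> \<le> k * dist (\<alpha> s) (\<delta> t)"
          using sep[OF that] k by (simp add: mult.assoc)
        finally show ?thesis .
      qed
      have \<alpha>\<delta>: "geodesic_on \<alpha> a" "geodesic_on \<delta> b"
        using ab \<alpha> \<delta> geodesic_on_subset by auto
      obtain w where w: "quasigeodesic k UNIV dist w 0 (a + l + b) (\<alpha> 0) (\<delta> 0)"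
        "\<alpha> a \<in> w ` {0..a + l + b}" "\<delta> b \<in> w ` {0..a + l + b}"
        using quasigeodesic_three_segments[OF \<alpha>\<delta>(1) \<beta>(1) \<alpha>\<delta>(2) \<beta>(2,3) k(2)
          left[folded l_def] right[folded l_def] sep'] by blast
      obtain z where z: "z \<in> Y" "dist (\<alpha> a) z \<le> D" using near[OF w(1) _ _ w(2)] \<alpha> \<delta> y by auto
      obtain z' where z': "z' \<in> Y" "dist (\<delta> b) z' \<le> D" using near[OF w(1) _ _ w(3)] \<alpha> \<delta> y by auto
      show ?thesis using proj1[OF ab(1) z(1)] proj2[OF ab(2) z'(1)] z z' by simp
    qed
    define B where "B = {0..r} \<times> {0..r'}"
    have B: "compact B" "B \<noteq> {}" using r r0 by (auto simp: B_def compact_Times)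
    have cont: "continuous_on B (\<lambda>z. dist (\<alpha> (fst z)) (\<delta> (snd z)))"
      unfolding B_def by (intro continuous_intros
        continuous_on_compose2[OF geodesic_on_continuous[OF \<alpha>(1)]]
        continuous_on_compose2[OF geodesic_on_continuous[OF \<delta>(1)]]) auto
    define C where "C = {z \<in> B. dist (\<alpha> (fst z)) (\<delta> (snd z)) \<le> h * r}"
    show "dist y1 y2 \<le> e * dist x1 y1"
    proof (cases "C = {}")
      case False
      have "compact (B \<inter> C)"
        unfolding C_def using continuous_closed_preimage[OF cont compact_imp_closed[OF B(1)], of "{..h * r}"]
        by (intro compact_Int_closed[OF B(1)]) (simp add: vimage_def Int_def)
      then have "compact C" by (simp add: C_def Int_def conj_ac)
      then obtain z where z: "z \<in> C" "\<And>z'. z' \<in> C \<Longrightarrow> fst z + snd z \<le> fst z' + snd z'"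
        using continuous_attains_inf[OF _ False continuous_on_add[OF continuous_on_fst continuous_on_snd,
          OF continuous_on_id continuous_on_id]] by blast
      define a b where "a = fst z" and "b = snd z"
      have ab: "a \<in> {0..r}" "b \<in> {0..r'}" "dist (\<alpha> a) (\<delta> b) \<le> h * r"
        using z(1) by (auto simp: C_def B_def a_def b_def)
      have min: "h * r < dist (\<alpha> s) (\<delta> t)" if "s \<in> {0..r}" "t \<in> {0..r'}" "s + t < a + b" for s t
        using z(2)[of "(s, t)"] that by (auto simp: C_def B_def a_def b_def not_le[symmetric])
      \<comment> \<open>A lowest pair of positive height lies at distance exactly h r: otherwise one
        of its points could descend by up to the slack \<open>c\<close> and the pair would remain in
        \<open>C\<close>.\<close>
      have eq: "h * r \<le> dist (\<alpha> a) (\<delta> b)" if "0 < a \<or> 0 < b"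
      proof (rule ccontr)
        assume neg: "\<not> h * r \<le> dist (\<alpha> a) (\<delta> b)"
        define c where "c = h * r - dist (\<alpha> a) (\<delta> b)"
        have c: "0 < c" using neg by (simp add: c_def)
        from that show False
        proof
          assume a: "0 < a"
          define s where "s = max 0 (a - c)"
          have s: "0 \<le> s" "s < a" "a - s \<le> c" using a c by (auto simp: s_def)
          have "dist (\<alpha> s) (\<alpha> a) = a - s" using s ab geodesic_on_dist[OF \<alpha>(1), of s a] by auto
          then have "dist (\<alpha> s) (\<delta> b) \<le> h * r"
            using dist_triangle[of "\<alpha> s" "\<delta> b" "\<alpha> a"] s by (simp add: c_def)
          then show False using min[of s b] s ab by simp
        next
          assume b: "0 < b"
          define s where "s = max 0 (b - c)"
          have s: "0 \<le> s" "s < b" "b - s \<le> c" using b c by (auto simp: s_def)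
          have "dist (\<delta> b) (\<delta> s) = b - s" using s ab geodesic_on_dist[OF \<delta>(1), of b s] by auto
          then have "dist (\<alpha> a) (\<delta> s) \<le> h * r"
            using dist_triangle[of "\<alpha> a" "\<delta> s" "\<delta> b"] s by (simp add: c_def)
          then show False using min[of a s] s ab by simp
        qed
      qed
      have "a \<le> D \<and> b \<le> D"
      proof (cases "0 < a \<or> 0 < b")
        case False
        then show ?thesis using D ab by auto
      next
        case True
        have sep: "h * r \<le> dist (\<alpha> s) (\<delta> t)" if "s \<in> {0..a}" "t \<in> {0..b}" for s t
        proof (cases "s + t < a + b")
          case True
          then show ?thesis using min[of s t] that ab by auto
        next
          case False
          then have "s = a" "t = b" using that by auto
          then show ?thesis using eq[OF True] by simp
        qed
        show ?thesis
        proof (rule low[OF ab(1,2) _ _ _ sep])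
          have "h * r \<le> r" using h r0 by simp
          then show "dist (\<alpha> a) (\<delta> b) \<le> r" using ab(3) by linarith
          show "dist (\<alpha> a) (\<delta> b) \<le> dist (\<alpha> s) (\<delta> b) + (a - s) / 2" if "s \<in> {0..a}" for s
          proof -
            have "0 \<le> (a - s) / 2" using that by simp
            then show ?thesis using sep[of s b] that ab(2,3) unfolding atLeastAtMost_iff by argo
          qed
          show "dist (\<alpha> a) (\<delta> b) \<le> dist (\<alpha> a) (\<delta> t) + (b - t) / 2" if "t \<in> {0..b}" for t
          proof -
            have "0 \<le> (b - t) / 2" using that by simp
            then show ?thesis using sep[of a t] that ab(1,3) unfolding atLeastAtMost_iff by argo
          qed
        qed
      qed
      moreover have "dist y1 (\<alpha> a) = a" "dist y2 (\<delta> b) = b"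
        using \<alpha> \<delta> ab geodesic_on_dist[OF \<alpha>(1), of 0 a] geodesic_on_dist[OF \<delta>(1), of 0 b] by auto
      ultimately have "dist y1 y2 \<le> 2 * D + h * r"
        using dist_triangle[of y1 y2 "\<alpha> a"] dist_triangle[of "\<alpha> a" y2 "\<delta> b"] ab(3)
        by (simp add: dist_commute)
      also have "\<dots> \<le> e * r"
      proof -
        have "h * r \<le> e * r / 2" "e * R \<le> e * r"
          using mult_right_mono[OF h(3), of r] mult_left_mono[OF r(1), of e] e r0 by auto
        then show ?thesis using R(3) by linarith
      qed
      finally show ?thesis by (simp add: r_def dist_commute)
    next
      case True
      have "continuous_on B (\<lambda>z. dist (\<alpha> (fst z)) (\<delta> (snd z)) + (r - fst z) / 2 + (r' - snd z) / 2)"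
        by (rule continuous_on_add[OF continuous_on_add[OF cont]]; intro continuous_intros) auto
      then obtain z where z: "z \<in> B" "\<And>z'. z' \<in> B \<Longrightarrow>
          dist (\<alpha> (fst z)) (\<delta> (snd z)) + (r - fst z) / 2 + (r' - snd z) / 2
          \<le> dist (\<alpha> (fst z')) (\<delta> (snd z')) + (r - fst z') / 2 + (r' - snd z') / 2"
        using continuous_attains_inf[OF B] by blast
      define a b where "a = fst z" and "b = snd z"
      have ab: "a \<in> {0..r}" "b \<in> {0..r'}"
        using z(1) by (auto simp: B_def a_def b_def)
      have min: "dist (\<alpha> a) (\<delta> b) + (r - a) / 2 + (r' - b) / 2
          \<le> dist (\<alpha> s) (\<delta> t) + (r - s) / 2 + (r' - t) / 2"
        if "s \<in> {0..r}" "t \<in> {0..r'}" for s t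
        using z(2)[of "(s, t)"] that by (simp add: B_def a_def b_def)
      \<comment> \<open>Comparison with the pair \<open>x1\<close>, \<open>x2\<close>, for which
        both penalties vanish.\<close>
      have top: "dist (\<alpha> a) (\<delta> b) + (r - a) / 2 + (r' - b) / 2 \<le> r / 4"
      proof -
        have "dist (\<alpha> a) (\<delta> b) + (r - a) / 2 + (r' - b) / 2 \<le> dist x1 x2"
          using min[of r r'] r r0 \<alpha> \<delta> by simp
        then show ?thesis using r(4) by linarith
      qed
      have "a \<le> D \<and> b \<le> D"
      proof (rule low[OF ab])
        show "dist (\<alpha> a) (\<delta> b) \<le> r"
          using top ab r0 unfolding atLeastAtMost_iff by argo
        show "dist (\<alpha> a) (\<delta> b) \<le> dist (\<alpha> s) (\<delta> b) + (a - s) / 2" if "s \<in> {0..a}" for s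
          using min[of s b] that ab unfolding atLeastAtMost_iff by argo
        show "dist (\<alpha> a) (\<delta> b) \<le> dist (\<alpha> a) (\<delta> t) + (b - t) / 2" if "t \<in> {0..b}" for t
          using min[of a t] that ab unfolding atLeastAtMost_iff by argo
        show "h * r \<le> dist (\<alpha> s) (\<delta> t)" if "s \<in> {0..a}" "t \<in> {0..b}" for s t
          using True that ab unfolding C_def B_def by force
      qed
      \<comment> \<open>This contradicts \<open>a \<le> D\<close>, since 2 D < R \<le> r.\<close>
      moreover have "r / 2 \<le> a"
        using top ab(2) zero_le_dist[of "\<alpha> a" "\<delta> b"]
        unfolding atLeastAtMost_iff by argo
      ultimately show ?thesis using r R by simp
    qed
  qed
  then show ?thesis using that R(1) by blast
qed

section \<open>Uniformly proper maps with stable image\<close>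

text \<open>The steps of the induction are as long as the contraction allows: a quarter of the current
  distance from the subspace.\<close>

lemma projection_displacement:
  fixes u p :: "nat \<Rightarrow> 'x::metric_space"
  assumes M: "0 < M" "4 * M \<le> R" and e: "0 \<le> e"
    and step: "\<And>i. dist (u i) (u (Suc i)) \<le> M"
    and near: "\<And>i j. dist (u i) (p i) \<le> dist (u i) (p j)"
    and contr: "\<And>i j. R \<le> dist (u i) (p i) \<Longrightarrow> dist (u i) (u j) \<le> dist (u i) (p i) / 4 \<Longrightarrow>
      dist (p i) (p j) \<le> e * dist (u i) (p i)"
    and far: "\<And>k. i \<le> k \<Longrightarrow> k \<le> j \<Longrightarrow> R < dist (u k) (p k)"
    and ij: "i \<le> j"
  shows "dist (p i) (p j) \<le> 8 * M * e * real (j - i) + 2 * e * dist (u j) (p j)"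
  using far ij
proof (induction "j - i" arbitrary: i rule: less_induct)
  case less
  have lip: "dist (u i) (u (i + k)) \<le> M * real k" for k
  proof (induction k)
    case (Suc k)
    then show ?case
      using dist_triangle[of "u i" "u (i + Suc k)" "u (i + k)"] step[of "i + k"]
      by (simp add: algebra_simps)
  qed simp
  define r where "r = dist (u i) (p i)"
  have r: "R < r" using less.prems by (simp add: r_def)
  \<comment> \<open>\<open>k\<close> steps cover at most r / 4, the range of the contraction. As r >
    4 M, \<open>k\<close> is positive and rounding down loses at most a factor 2, so r \<le> 8 M k:
    a displacement e r is paid for by \<open>k\<close> steps.\<close>
  define k where "k = nat \<lfloor>r / (4 * M)\<rfloor>"
  have "1 \<le> r / (4 * M)" using r M by (simp add: field_simps)
  then have k: "1 \<le> k" "real k \<le> r / (4 * M)" "r / (4 * M) < real k + 1"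
    unfolding k_def by (auto simp: le_nat_iff le_floor_iff)
  then have "r / (4 * M) \<le> 2 * real k" by linarith
  then have Mk: "M * real k \<le> r / 4" "r \<le> 8 * M * real k"
    using k M by (auto simp: field_simps)
  show ?case
  proof (cases "i + k \<le> j")
    case True
    have "dist (p i) (p (i + k)) \<le> e * r"
      unfolding r_def using r lip[of k] Mk by (intro contr) (auto simp: r_def)
    also have "\<dots> \<le> 8 * M * e * real k"
      using mult_left_mono[OF Mk(2) e] by (simp add: mult_ac)
    finally have "dist (p i) (p (i + k)) \<le> 8 * M * e * real k" .
    moreover have "dist (p (i + k)) (p j) \<le> 8 * M * e * real (j - (i + k)) + 2 * e * dist (u j) (p j)"
      using less.prems True k by (intro less.hyps) auto
    moreover have "real (j - i) = real k + real (j - (i + k))" using True by simp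
    ultimately show ?thesis
      using dist_triangle[of "p i" "p j" "p (i + k)"] by (simp add: distrib_left)
  next
    case False
    have "dist (u i) (u j) \<le> M * real (j - i)" using lip[of "j - i"] less.prems by simp
    also have "\<dots> \<le> M * real k" using False M by (intro mult_left_mono) auto
    finally have ij: "dist (u i) (u j) \<le> r / 4" using Mk by simp
    then have "dist (p i) (p j) \<le> e * r"
      unfolding r_def using r by (intro contr) (auto simp: r_def)
    \<comment> \<open>The last jump may be too short to pay for itself. Since \<open>u i\<close> and
      \<open>u j\<close> are within r / 4, their distances to the subspace are comparable, which
      yields the additive term.\<close>
    moreover have "r \<le> 2 * dist (u j) (p j)"
      using near[of i j] dist_triangle[of "u i" "p j" "u j"] ij r M by (simp add: r_def)
    then have "e * r \<le> 2 * e * dist (u j) (p j)"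
      using mult_left_mono[OF _ e] by fastforce
    moreover have "0 \<le> 8 * M * e * real (j - i)" using M e by simp
    ultimately show ?thesis by linarith
  qed
qed

lemma subdivision:
  fixes s t \<tau> :: real
  assumes "s \<le> \<tau>" "\<tau> \<le> t"
  obtains i where "s + real i \<le> \<tau>" "\<tau> < s + real i + 1" "i \<le> nat \<lceil>t - s\<rceil>"
proof
  have "real (nat \<lfloor>\<tau> - s\<rfloor>) = real_of_int \<lfloor>\<tau> - s\<rfloor>" using assms by simp
  then show "s + real (nat \<lfloor>\<tau> - s\<rfloor>) \<le> \<tau>" "\<tau> < s + real (nat \<lfloor>\<tau> - s\<rfloor>) + 1"
    by linarith+
  show "nat \<lfloor>\<tau> - s\<rfloor> \<le> nat \<lceil>t - s\<rceil>"
    using assms by (intro nat_mono) linarith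
qed

text \<open>No lower bound on the distances of \<open>f\<close> in terms of \<open>d\<close> is assumed off \<open>H\<close> beyond uniform
  properness, so \<open>f\<close> need not map quasigeodesics to quasigeodesics.\<close>

locale proper_map_with_stable_image =
  fixes \<Gamma> :: "'g set" and d :: "'g \<Rightarrow> 'g \<Rightarrow> real" and H :: "'g set"
    and f :: "'g \<Rightarrow> 'x::metric_space" and L A k0 :: real
  assumes d_refl: "g \<in> \<Gamma> \<Longrightarrow> d g g = 0"
    and d_sym: "g \<in> \<Gamma> \<Longrightarrow> h \<in> \<Gamma> \<Longrightarrow> d g h = d h g"
    and d_triangle: "g \<in> \<Gamma> \<Longrightarrow> h \<in> \<Gamma> \<Longrightarrow> k \<in> \<Gamma> \<Longrightarrow> d g k \<le> d g h + d h k"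
    and H: "H \<subseteq> \<Gamma>"
    and L: "0 < L" and lip: "g \<in> \<Gamma> \<Longrightarrow> h \<in> \<Gamma> \<Longrightarrow> dist (f g) (f h) \<le> L * d g h"
    and proper: "\<exists>B. \<forall>g\<in>\<Gamma>. \<forall>h\<in>\<Gamma>. dist (f g) (f h) \<le> R \<longrightarrow> d g h \<le> B"
    and A: "1 \<le> A" and undistorted: "g \<in> H \<Longrightarrow> h \<in> H \<Longrightarrow> d g h \<le> A * dist (f g) (f h) + A"
    and nearest: "g \<in> \<Gamma> \<Longrightarrow> \<exists>h\<in>H. \<forall>h'\<in>H. dist (f g) (f h) \<le> dist (f g) (f h')"
    and geodesic: "geodesic_space TYPE('x)"
    and stable: "stable_subspace (f ` H) dist UNIV dist"
    and conn: "a \<in> f ` H \<Longrightarrow> b \<in> f ` H \<Longrightarrow>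
      \<exists>q s t. quasigeodesic k0 UNIV dist q s t a b \<and> q ` {s..t} \<subseteq> f ` H"
begin

lemma quasigeodesic_near:
  assumes k: "1 \<le> k"
  obtains E where "0 \<le> E"
    and "\<And>q s t a b \<tau>. quasigeodesic k \<Gamma> d q s t a b \<Longrightarrow> a \<in> H \<Longrightarrow> b \<in> H \<Longrightarrow> \<tau> \<in> {s..t} \<Longrightarrow>
      \<exists>h\<in>H. d (q \<tau>) h \<le> E"
proof -
  \<comment> \<open>A unit parameter step moves \<open>q\<close> by at most 2 k in \<open>d\<close>,
    hence its image under \<open>f\<close> by at most \<open>M\<close>.\<close>
  define M where "M = 2 * L * k"
  have M: "0 < M" using k L by (simp add: M_def)
  \<comment> \<open>Chosen so that \<open>A\<close> times the drift 8 M e n of the projection is n /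
    (2 k), half of the progress n / k forced on a quasigeodesic.\<close>
  define e where "e = 1 / (16 * k * A * M)"
  have e: "0 < e" using k A M by (simp add: e_def)
  have eA: "A * (8 * M * e * x) = x / (2 * k)" for x using k A M by (simp add: e_def field_simps)
  obtain R0 where R0: "0 < R0" and
    contr: "\<And>x1 x2 y1 y2. y1 \<in> f ` H \<Longrightarrow> y2 \<in> f ` H \<Longrightarrow>
      (\<And>y. y \<in> f ` H \<Longrightarrow> dist x1 y1 \<le> dist x1 y) \<Longrightarrow> (\<And>y. y \<in> f ` H \<Longrightarrow> dist x2 y2 \<le> dist x2 y) \<Longrightarrow>
      R0 \<le> dist x1 y1 \<Longrightarrow> dist x1 x2 \<le> dist x1 y1 / 4 \<Longrightarrow> dist y1 y2 \<le> e * dist x1 y1"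
    using stable_subspace_contracting[OF geodesic stable conn e] by metis
  define R where "R = max R0 (4 * M)"
  have R: "R0 \<le> R" "4 * M \<le> R" by (auto simp: R_def)
  \<comment> \<open>The radius is \<open>R + M\<close> because the ends of an excursion away from
    the subspace are one step beyond a point within \<open>R\<close> of it.\<close>
  obtain B0 where B0: "\<And>g h. g \<in> \<Gamma> \<Longrightarrow> h \<in> \<Gamma> \<Longrightarrow> dist (f g) (f h) \<le> R + M \<Longrightarrow> d g h \<le> B0"
    using proper[of "R + M"] by blast
  define B where "B = max B0 0"
  have B: "0 \<le> B" "\<And>g h. g \<in> \<Gamma> \<Longrightarrow> h \<in> \<Gamma> \<Longrightarrow> dist (f g) (f h) \<le> R + M \<Longrightarrow> d g h \<le> B"
    using B0 by (auto simp: B_def le_max_iff_disj)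
  \<comment> \<open>The bound on n that results from n / k \<le> n / (2 k) + 2 B + 2 A e (R + M) + A
    + k.\<close>
  define K where "K = 2 * k * (2 * B + 2 * A * e * (R + M) + A + k)"
  have K: "0 \<le> K" using k A B(1) e M R by (simp add: K_def)
  obtain \<eta> where \<eta>: "\<And>g. g \<in> \<Gamma> \<Longrightarrow> \<eta> g \<in> H"
    "\<And>g h. g \<in> \<Gamma> \<Longrightarrow> h \<in> H \<Longrightarrow> dist (f g) (f (\<eta> g)) \<le> dist (f g) (f h)"
    using nearest by metis
  \<comment> \<open>Going back to the start of an excursion costs at most k K + k, and from there to
    \<open>H\<close> at most \<open>B\<close>.\<close>
  define E where "E = k * K + k + B"
  have E: "0 \<le> E" "B \<le> E" using k K B(1) by (auto simp: E_def)
  have near: "\<exists>h\<in>H. d (q \<tau>) h \<le> E + 2 * k"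
    if q: "quasigeodesic k \<Gamma> d q s t a b" and ab: "a \<in> H" "b \<in> H" and \<tau>: "\<tau> \<in> {s..t}" for q s t a b \<tau>
  proof -
    have q\<Gamma>: "\<And>u. u \<in> {s..t} \<Longrightarrow> q u \<in> \<Gamma>" and st: "s \<le> t" and q_ends: "q s = a" "q t = b" and
      q_le: "\<And>u v. u \<in> {s..t} \<Longrightarrow> v \<in> {s..t} \<Longrightarrow> d (q u) (q v) \<le> k * \<bar>u - v\<bar> + k" and
      q_ge: "\<And>u v. u \<in> {s..t} \<Longrightarrow> v \<in> {s..t} \<Longrightarrow> \<bar>u - v\<bar> / k - k \<le> d (q u) (q v)"
      using q by (auto simp: quasigeodesic_def qi_embedding_with_def dist_real_def)
    \<comment> \<open>Clipping at \<open>t\<close> makes sample \<open>N\<close> the endpoint of the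
      path; the samples before it are spaced by exactly 1.\<close>
    define T where "T i = min (s + real i) t" for i
    have T: "T i \<in> {s..t}" for i using st by (auto simp: T_def)
    define g where "g i = q (T i)" for i
    define N where "N = nat \<lceil>t - s\<rceil>"
    have N: "t \<le> s + real N" "\<And>n. n < N \<Longrightarrow> s + real n < t"
      using st unfolding N_def by linarith+
    have g: "g i \<in> \<Gamma>" for i using q\<Gamma> T by (simp add: g_def)
    have g_ends: "g 0 = a" "g N = b" using st N q_ends by (auto simp: g_def T_def)
    define u p where "u i = f (g i)" and "p i = f (\<eta> (g i))" for i
    have pH: "p i \<in> f ` H" for i using \<eta> g by (auto simp: p_def)
    have up: "dist (u i) (p i) \<le> dist (u i) y" if "y \<in> f ` H" for i y
      using \<eta>(2)[OF g] that by (auto simp: u_def p_def)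
    have step: "dist (u i) (u (Suc i)) \<le> M" for i
    proof -
      have "\<bar>T i - T (Suc i)\<bar> \<le> 1" by (auto simp: T_def)
      then have "d (g i) (g (Suc i)) \<le> k * 1 + k"
        unfolding g_def using q_le[OF T T, of i "Suc i"] k mult_left_mono[of "\<bar>T i - T (Suc i)\<bar>" 1 k] by linarith
      then have "L * d (g i) (g (Suc i)) \<le> L * (2 * k)" using L by (intro mult_left_mono) auto
      then show ?thesis using lip[OF g g, of i "Suc i"] by (simp add: u_def M_def mult_ac)
    qed
    have index: "\<exists>h\<in>H. d (g i) h \<le> E" if i: "i \<le> N" for i
    proof (cases "dist (u i) (p i) \<le> R")
      case True
      then have "d (g i) (\<eta> (g i)) \<le> B"
        using B(2)[OF g subsetD[OF H \<eta>(1)[OF g]], of i i] M by (simp add: u_def p_def)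
      then have "d (g i) (\<eta> (g i)) \<le> E" using E by simp
      then show ?thesis using \<eta>(1)[OF g] by blast
    next
      case False
      define P where "P j \<longleftrightarrow> dist (u j) (p j) \<le> R" for j
      have "dist (u j) (p j) \<le> 0" if "g j \<in> H" for j using up[of "u j" j] that by (simp add: u_def)
      then have P: "P 0" "P N" using g_ends ab R0 R by (force simp: P_def)+
      \<comment> \<open>The indices around \<open>i\<close> with distance at most \<open>R\<close>
        exist because both endpoints lie in \<open>H\<close>. Moving one step inwards from them
        gives \<open>m\<close> and \<open>n\<close>: everything from \<open>m\<close> to
        \<open>n\<close> is far, yet these two are still within \<open>R + M\<close>.\<close>
      define i1 where "i1 = (GREATEST j. j \<le> i \<and> P j)"
      define i2 where "i2 = (LEAST j. i \<le> j \<and> P j)"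
      have i1: "i1 \<le> i \<and> P i1" "\<And>j. j \<le> i \<Longrightarrow> P j \<Longrightarrow> j \<le> i1"
        unfolding i1_def using P(1) GreatestI_nat[of "\<lambda>j. j \<le> i \<and> P j" 0 i]
          Greatest_le_nat[of "\<lambda>j. j \<le> i \<and> P j" _ i] by blast+
      have i2: "i \<le> i2 \<and> P i2" "\<And>j. i \<le> j \<Longrightarrow> P j \<Longrightarrow> i2 \<le> j"
        unfolding i2_def using P(2) i LeastI[of "\<lambda>j. i \<le> j \<and> P j" N]
          Least_le[of "\<lambda>j. i \<le> j \<and> P j"] by blast+
      have nP: "\<not> P i" using False by (simp add: P_def)
      then have lt: "i1 < i" "i < i2" using i1(1) i2(1) by (metis le_neq_implies_less)+
      define m n where "m = Suc i1" and "n = i2 - 1"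
      have mn: "m \<le> i" "i \<le> n" "Suc n = i2" "n < N"
        using lt i2(2)[OF i P(2)] by (auto simp: m_def n_def)
      have far: "R < dist (u j) (p j)" if "m \<le> j" "j \<le> n" for j
        using i1(2)[of j] i2(2)[of j] that mn by (force simp: P_def m_def not_le[symmetric])
      have m_le: "dist (u m) (p m) \<le> R + M"
        using up[OF pH[of i1], of m] dist_triangle[of "u m" "p i1" "u i1"] step[of i1] i1(1)
        by (simp add: m_def P_def dist_commute)
      have n_le: "dist (u n) (p n) \<le> R + M"
        using up[OF pH[of i2], of n] dist_triangle[of "u n" "p i2" "u i2"] step[of n] i2(1) mn(3)
        by (simp add: P_def)
      have "dist (p m) (p n) \<le> 8 * M * e * real (n - m) + 2 * e * dist (u n) (p n)"
      proof (rule projection_displacement[where R = R and u = u and p = p])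
        show "dist (p i) (p j) \<le> e * dist (u i) (p i)"
          if "R \<le> dist (u i) (p i)" "dist (u i) (u j) \<le> dist (u i) (p i) / 4" for i j
          using that R by (intro contr[OF pH pH up up]) auto
      qed (use M R(2) e step up pH far mn in auto)
      also have "\<dots> \<le> 8 * M * e * real (n - m) + 2 * e * (R + M)"
        using n_le e by simp
      finally have "A * dist (p m) (p n) \<le> A * (8 * M * e * real (n - m) + 2 * e * (R + M))"
        using A by (intro mult_left_mono) auto
      also have "\<dots> = A * (8 * M * e * real (n - m)) + 2 * A * e * (R + M)"
        by (simp add: distrib_left mult_ac)
      finally have p_le: "A * dist (p m) (p n) \<le> real (n - m) / (2 * k) + 2 * A * e * (R + M)"
        unfolding eA .
      have \<eta>\<Gamma>: "\<eta> (g j) \<in> \<Gamma>" for j using \<eta>(1)[OF g] H by blast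
      have "d (g m) (\<eta> (g m)) \<le> B" "d (\<eta> (g n)) (g n) \<le> B"
        using B(2)[OF g \<eta>\<Gamma>] m_le n_le d_sym[OF g \<eta>\<Gamma>] by (auto simp: u_def p_def)
      moreover have "d (g m) (g n) \<le> d (g m) (\<eta> (g m)) + d (\<eta> (g m)) (\<eta> (g n)) + d (\<eta> (g n)) (g n)"
        using d_triangle[OF g \<eta>\<Gamma> g, of m n m] d_triangle[OF \<eta>\<Gamma> \<eta>\<Gamma> g, of m n n] by simp
      moreover have "d (\<eta> (g m)) (\<eta> (g n)) \<le> A * dist (p m) (p n) + A"
        using undistorted[OF \<eta>(1)[OF g] \<eta>(1)[OF g]] by (simp add: p_def)
      \<comment> \<open>No clipping occurs up to \<open>n < N\<close>, so the parameter differences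
        are exact.\<close>
      moreover have Tm: "\<bar>T m - T j\<bar> = real (j - m)" if "m \<le> j" "j \<le> n" for j
        using N(2)[OF mn(4)] that by (auto simp: T_def)
      then have "real (n - m) / k - k \<le> d (g m) (g n)"
        using q_ge[OF T T, of m n] mn by (simp add: g_def)
      ultimately have "real (n - m) / k \<le> real (n - m) / (2 * k) + (2 * B + 2 * A * e * (R + M) + A + k)"
        using p_le by linarith
      then have "real (n - m) \<le> K" using k by (simp add: K_def field_simps)
      then have "real (i - m) \<le> K" using mn by simp
      then have "k * \<bar>T m - T i\<bar> \<le> k * K" using Tm[OF mn(1,2)] k by simp
      then have "d (g m) (g i) \<le> k * K + k" using q_le[OF T T, of m i] by (simp add: g_def)
      then have "d (g i) (\<eta> (g m)) \<le> E"
        using d_triangle[OF g g \<eta>\<Gamma>, of i m m] d_sym[OF g g, of i m] \<open>d (g m) (\<eta> (g m)) \<le> B\<close>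
        by (simp add: E_def)
      then show ?thesis using \<eta>(1)[OF g] by blast
    qed
    obtain i where i: "s + real i \<le> \<tau>" "\<tau> < s + real i + 1" "i \<le> N"
      using subdivision[of s \<tau> t] \<tau> unfolding N_def by auto
    obtain h where h: "h \<in> H" "d (g i) h \<le> E" using index[OF i(3)] by blast
    have "\<bar>\<tau> - T i\<bar> \<le> 1" using i \<tau> by (auto simp: T_def)
    then have "d (q \<tau>) (g i) \<le> 2 * k"
      using q_le[OF \<tau> T, of i] k mult_left_mono[of "\<bar>\<tau> - T i\<bar>" 1 k] unfolding g_def by linarith
    then show ?thesis
      using h d_triangle[OF q\<Gamma>[OF \<tau>] g, of h i] H by (intro bexI[of _ h]) auto
  qed
  show ?thesis using that[of "E + 2 * k"] near E k by simp
qed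

theorem quasigeodesics_close:
  assumes "1 < k"
  shows "\<exists>D>0. \<forall>a\<in>H. \<forall>b\<in>H. \<forall>q s t q' s' t'.
    quasigeodesic k \<Gamma> d q s t a b \<longrightarrow> quasigeodesic k \<Gamma> d q' s' t' a b \<longrightarrow>
    hausdorff_close d D (q ` {s..t}) (q' ` {s'..t'})"
proof -
  have k: "1 \<le> k" using assms by simp
  obtain E where E: "0 \<le> E"
    "\<And>q s t a b \<tau>. quasigeodesic k \<Gamma> d q s t a b \<Longrightarrow> a \<in> H \<Longrightarrow> b \<in> H \<Longrightarrow> \<tau> \<in> {s..t} \<Longrightarrow>
      \<exists>h\<in>H. d (q \<tau>) h \<le> E"
    using quasigeodesic_near[OF k] by metis
  \<comment> \<open>Fixing \<open>H\<close> pointwise keeps the endpoints of the pushed path. The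
    choice is meaningful only within \<open>E\<close> of \<open>H\<close>, where the path
    stays.\<close>
  define \<sigma> where "\<sigma> g = (if g \<in> H then g else SOME h. h \<in> H \<and> d g h \<le> E)" for g
  have \<sigma>H: "\<sigma> g = g" if "g \<in> H" for g using that by (simp add: \<sigma>_def)
  have \<sigma>: "\<sigma> (q \<tau>) \<in> H \<and> d (q \<tau>) (\<sigma> (q \<tau>)) \<le> E"
    if "quasigeodesic k \<Gamma> d q s t a b" "a \<in> H" "b \<in> H" "\<tau> \<in> {s..t}" for q s t a b \<tau>
    using someI_ex[OF E(2)[OF that, unfolded Bex_def]] d_refl H E(1) by (auto simp: \<sigma>_def)
  define c where "c = k + 2 * E"
  \<comment> \<open>The sum dominates every constant required: A k and L k for the slopes, L c and A
    + c for the errors. Here \<open>c\<close> allows for moving both points by up to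
    \<open>E\<close>.\<close>
  define k2 where "k2 = 1 + A * k + L * k + L * c + (A + c)"
  have c: "1 \<le> c" using k E by (simp add: c_def)
  have "0 \<le> A * k" "0 \<le> L * k" "0 \<le> L * c" using A L k c by auto
  then have k2: "1 < k2" "A * k \<le> k2" "L * k \<le> k2" "L * c \<le> k2" "A + c \<le> k2"
    using A c unfolding k2_def by linarith+
  have push: "quasigeodesic k2 UNIV dist (\<lambda>\<tau>. f (\<sigma> (q \<tau>))) s t (f a) (f b)"
    if q: "quasigeodesic k \<Gamma> d q s t a b" "a \<in> H" "b \<in> H" for q s t a b
  proof -
    have q\<Gamma>: "\<And>u. u \<in> {s..t} \<Longrightarrow> q u \<in> \<Gamma>" and st: "s \<le> t" and q_ends: "q s = a" "q t = b" and
      q_le: "\<And>u v. u \<in> {s..t} \<Longrightarrow> v \<in> {s..t} \<Longrightarrow> d (q u) (q v) \<le> k * \<bar>u - v\<bar> + k" and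
      q_ge: "\<And>u v. u \<in> {s..t} \<Longrightarrow> v \<in> {s..t} \<Longrightarrow> \<bar>u - v\<bar> / k - k \<le> d (q u) (q v)"
      using q by (auto simp: quasigeodesic_def qi_embedding_with_def dist_real_def)
    have "\<bar>u - v\<bar> / k2 - k2 \<le> dist (f (\<sigma> (q u))) (f (\<sigma> (q v))) \<and>
      dist (f (\<sigma> (q u))) (f (\<sigma> (q v))) \<le> k2 * \<bar>u - v\<bar> + k2" if uv: "u \<in> {s..t}" "v \<in> {s..t}" for u v
    proof
      define x y where "x = \<sigma> (q u)" and "y = \<sigma> (q v)"
      have xy: "x \<in> H" "y \<in> H" "d (q u) x \<le> E" "d (q v) y \<le> E"
        using \<sigma>[OF q] uv by (auto simp: x_def y_def)
      note \<Gamma> = q\<Gamma>[OF uv(1)] q\<Gamma>[OF uv(2)] subsetD[OF H xy(1)] subsetD[OF H xy(2)]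
      have "d x y \<le> k * \<bar>u - v\<bar> + c"
        using q_le[OF uv] d_triangle[OF \<Gamma>(3,1,4)] d_triangle[OF \<Gamma>(1,2,4)] d_sym[OF \<Gamma>(1,3)] xy
        by (simp add: c_def)
      then have "L * d x y \<le> L * (k * \<bar>u - v\<bar> + c)" using L by (intro mult_left_mono) auto
      also have "\<dots> = L * k * \<bar>u - v\<bar> + L * c" by (simp add: algebra_simps)
      also have "\<dots> \<le> k2 * \<bar>u - v\<bar> + k2" using k2 by (intro add_mono mult_right_mono) auto
      finally show "dist (f (\<sigma> (q u))) (f (\<sigma> (q v))) \<le> k2 * \<bar>u - v\<bar> + k2"
        using lip[OF \<Gamma>(3,4)] by (simp add: x_def y_def)
      have "\<bar>u - v\<bar> / k - c \<le> d x y"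
        using q_ge[OF uv] d_triangle[OF \<Gamma>(1,3,2)] d_triangle[OF \<Gamma>(3,4,2)] d_sym[OF \<Gamma>(2,4)] xy
        by (simp add: c_def)
      then have "\<bar>u - v\<bar> / k \<le> A * dist (f x) (f y) + (A + c)"
        using undistorted[OF xy(1,2)] by simp
      \<comment> \<open>Enlarging the error to A k2 allows division by \<open>A\<close>.\<close>
      also have "\<dots> \<le> A * dist (f x) (f y) + A * k2"
        using k2(1,5) mult_right_mono[OF A, of k2] by linarith
      finally have "\<bar>u - v\<bar> / k \<le> A * (dist (f x) (f y) + k2)" by (simp add: distrib_left)
      then have "\<bar>u - v\<bar> / (A * k) \<le> dist (f x) (f y) + k2"
        using A k by (simp add: field_simps)
      moreover have "\<bar>u - v\<bar> / k2 \<le> \<bar>u - v\<bar> / (A * k)"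
        using k2(1,2) A k by (intro divide_left_mono mult_pos_pos) auto
      ultimately show "\<bar>u - v\<bar> / k2 - k2 \<le> dist (f (\<sigma> (q u))) (f (\<sigma> (q v)))"
        by (simp add: x_def y_def)
    qed
    then show ?thesis
      using st k2(1) q_ends \<sigma>H q(2,3)
      by (auto simp: quasigeodesic_def qi_embedding_with_def dist_real_def)
  qed
  obtain D where D: "0 < D" and
    D': "\<And>a b q s t q' s' t'. a \<in> f ` H \<Longrightarrow> b \<in> f ` H \<Longrightarrow> quasigeodesic k2 UNIV dist q s t a b \<Longrightarrow>
      quasigeodesic k2 UNIV dist q' s' t' a b \<Longrightarrow> hausdorff_close dist D (q ` {s..t}) (q' ` {s'..t'})"
    using stable k2(1) unfolding stable_subspace_def by meson
  define D2 where "D2 = 2 * E + A * D + A"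
  have half: "\<exists>y\<in>q' ` {s'..t'}. d x y \<le> D2"
    if q: "quasigeodesic k \<Gamma> d q s t a b" and q': "quasigeodesic k \<Gamma> d q' s' t' a b"
      and ab: "a \<in> H" "b \<in> H" and x: "x \<in> q ` {s..t}" for q s t q' s' t' a b x
  proof -
    obtain u where u: "u \<in> {s..t}" "x = q u" using x by blast
    have "hausdorff_close dist D ((\<lambda>\<tau>. f (\<sigma> (q \<tau>))) ` {s..t}) ((\<lambda>\<tau>. f (\<sigma> (q' \<tau>))) ` {s'..t'})"
      using ab by (intro D'[OF _ _ push[OF q ab] push[OF q' ab]]) auto
    then obtain v where v: "v \<in> {s'..t'}" "dist (f (\<sigma> (q u))) (f (\<sigma> (q' v))) \<le> D"
      using u unfolding hausdorff_close_def by blast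
    note \<sigma>u = \<sigma>[OF q ab u(1)] and \<sigma>v = \<sigma>[OF q' ab v(1)]
    have \<Gamma>: "q u \<in> \<Gamma>" "q' v \<in> \<Gamma>" "\<sigma> (q u) \<in> \<Gamma>" "\<sigma> (q' v) \<in> \<Gamma>"
      using q q' u v \<sigma>u \<sigma>v H by (auto simp: quasigeodesic_def qi_embedding_with_def)
    \<comment> \<open>Closeness in the target pulls back linearly because both points are in
      \<open>H\<close>.\<close>
    have "d (\<sigma> (q u)) (\<sigma> (q' v)) \<le> A * dist (f (\<sigma> (q u))) (f (\<sigma> (q' v))) + A"
      using undistorted \<sigma>u \<sigma>v by simp
    also have "\<dots> \<le> A * D + A" using v(2) A by simp
    finally have "d (q u) (q' v) \<le> D2"
      using d_triangle[OF \<Gamma>(1,3,2)] d_triangle[OF \<Gamma>(3,4,2)] d_sym[OF \<Gamma>(2,4)] \<sigma>u \<sigma>v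
      by (simp add: D2_def)
    then show ?thesis using u v by blast
  qed
  show ?thesis
  proof (intro exI[of _ D2] conjI ballI allI impI)
    show "0 < D2" using E(1) A D by (simp add: D2_def add_nonneg_pos)
    fix a b q s t q' s' t'
    assume "a \<in> H" "b \<in> H" "quasigeodesic k \<Gamma> d q s t a b" "quasigeodesic k \<Gamma> d q' s' t' a b"
    then show "hausdorff_close d D2 (q ` {s..t}) (q' ` {s'..t'})"
      unfolding hausdorff_close_def by (intro conjI ballI half)
  qed
qed

end

section \<open>Word metrics\<close>

context group
begin

section \<open>Words and word length\<close>

lemma letters_subset: "S \<subseteq> carrier G \<Longrightarrow> S \<union> m_inv G ` S \<subseteq> carrier G"
  by auto

lemma word_closed: "set ws \<subseteq> carrier G \<Longrightarrow> foldr (\<otimes>) ws \<one> \<in> carrier G"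
  by (induction ws) auto

lemma word_append:
  "set us \<subseteq> carrier G \<Longrightarrow> set vs \<subseteq> carrier G \<Longrightarrow>
    foldr (\<otimes>) (us @ vs) \<one> = foldr (\<otimes>) us \<one> \<otimes> foldr (\<otimes>) vs \<one>"
  by (induction us) (auto simp: m_assoc word_closed simp del: foldr_append)

lemma word_inverse:
  "set ws \<subseteq> carrier G \<Longrightarrow> inv (foldr (\<otimes>) ws \<one>) = foldr (\<otimes>) (rev (map (m_inv G) ws)) \<one>"
proof (induction ws)
  case (Cons a ws)
  have "foldr (\<otimes>) (rev (map (m_inv G) ws) @ [inv a]) \<one>
      = foldr (\<otimes>) (rev (map (m_inv G) ws)) \<one> \<otimes> inv a"
    using Cons.prems by (subst word_append) auto
  then show ?case using Cons by (simp add: inv_mult_group word_closed del: foldr_append)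
qed simp

lemma word_in_generate:
  "S \<subseteq> carrier G \<Longrightarrow> set ws \<subseteq> S \<union> m_inv G ` S \<Longrightarrow> foldr (\<otimes>) ws \<one> \<in> generate G S"
  by (induction ws) (auto intro: generate.one generate.incl generate.inv generate.eng)

lemma generate_imp_word:
  assumes "S \<subseteq> carrier G" "g \<in> generate G S"
  shows "\<exists>ws. set ws \<subseteq> S \<union> m_inv G ` S \<and> foldr (\<otimes>) ws \<one> = g"
  using assms(2)
proof (induction g)
  case one
  show ?case by (rule exI[of _ "[]"]) simp
next
  case (incl h)
  then show ?case using assms(1) by (intro exI[of _ "[h]"]) auto
next
  case (inv h)
  then show ?case using assms(1) by (intro exI[of _ "[inv h]"]) auto
next
  case (eng g h)
  then obtain us vs where "set us \<subseteq> S \<union> m_inv G ` S" "foldr (\<otimes>) us \<one> = g"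
    "set vs \<subseteq> S \<union> m_inv G ` S" "foldr (\<otimes>) vs \<one> = h" by blast
  then show ?case
    using word_append[of us vs] letters_subset[OF assms(1)]
    by (intro exI[of _ "us @ vs"]) (auto simp del: foldr_append)
qed

lemma shortest_word:
  assumes "S \<subseteq> carrier G" "g \<in> generate G S"
  obtains ws where "length ws = word_length G S g" "set ws \<subseteq> S \<union> m_inv G ` S" "foldr (\<otimes>) ws \<one> = g"
  using LeastI_ex[of "\<lambda>n. \<exists>ws. length ws = n \<and> set ws \<subseteq> S \<union> m_inv G ` S \<and> foldr (\<otimes>) ws \<one> = g"]
    generate_imp_word[OF assms] unfolding word_length_def by blast

lemma word_length_le: "set ws \<subseteq> S \<union> m_inv G ` S \<Longrightarrow> word_length G S (foldr (\<otimes>) ws \<one>) \<le> length ws"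
  unfolding word_length_def by (rule Least_le) blast

lemma word_length_one: "word_length G S \<one> = 0"
  using word_length_le[of "[]"] by simp

lemma word_length_mult_le:
  assumes "S \<subseteq> carrier G" "g \<in> generate G S" "h \<in> generate G S"
  shows "word_length G S (g \<otimes> h) \<le> word_length G S g + word_length G S h"
proof -
  obtain us where us: "length us = word_length G S g" "set us \<subseteq> S \<union> m_inv G ` S" "foldr (\<otimes>) us \<one> = g"
    using shortest_word[OF assms(1,2)] .
  obtain vs where vs: "length vs = word_length G S h" "set vs \<subseteq> S \<union> m_inv G ` S" "foldr (\<otimes>) vs \<one> = h"
    using shortest_word[OF assms(1,3)] .
  have "foldr (\<otimes>) (us @ vs) \<one> = g \<otimes> h"
    using us vs letters_subset[OF assms(1)] by (subst word_append) auto
  then show ?thesis using word_length_le[of "us @ vs" S] us vs by simp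
qed

lemma word_length_inv_le:
  assumes "S \<subseteq> carrier G" "g \<in> generate G S"
  shows "word_length G S (inv g) \<le> word_length G S g"
proof -
  obtain us where us: "length us = word_length G S g" "set us \<subseteq> S \<union> m_inv G ` S" "foldr (\<otimes>) us \<one> = g"
    using shortest_word[OF assms] .
  have "set us \<subseteq> carrier G" using us(2) letters_subset[OF assms(1)] by (rule order_trans)
  then have "foldr (\<otimes>) (rev (map (m_inv G) us)) \<one> = inv g"
    using word_inverse[of us] us(3) by simp
  moreover have "m_inv G ` set us \<subseteq> S \<union> m_inv G ` S"
    using us(2) assms(1) by (auto simp: subset_iff)
  ultimately show ?thesis using word_length_le[of "rev (map (m_inv G) us)" S] us(1) by simp
qed

lemma word_length_inv:
  assumes "S \<subseteq> carrier G" "g \<in> generate G S"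
  shows "word_length G S (inv g) = word_length G S g"
proof (rule antisym)
  have "g \<in> carrier G" "inv g \<in> generate G S"
    using assms generate_in_carrier generate_m_inv_closed by auto
  then show "word_length G S g \<le> word_length G S (inv g)"
    using word_length_inv_le[OF assms(1), of "inv g"] by simp
qed (rule word_length_inv_le[OF assms])

text \<open>Induction along a shortest word, each letter costing at most \<open>C\<close>. Taking
  \<open>F\<close> to be another word length, or the displacement of a base point, gives the
  Lipschitz bounds below.\<close>

lemma le_word_length:
  fixes F :: "'a \<Rightarrow> real"
  assumes S: "S \<subseteq> carrier G" and one: "F \<one> \<le> 0"
    and letter: "\<And>s g. s \<in> S \<union> m_inv G ` S \<Longrightarrow> g \<in> generate G S \<Longrightarrow> F (s \<otimes> g) \<le> C + F g"
    and g: "g \<in> generate G S"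
  shows "F g \<le> C * real (word_length G S g)"
proof -
  have "F (foldr (\<otimes>) ws \<one>) \<le> C * real (length ws)" if "set ws \<subseteq> S \<union> m_inv G ` S" for ws
    using that
  proof (induction ws)
    case (Cons s ws)
    then show ?case
      using letter[of s "foldr (\<otimes>) ws \<one>"] word_in_generate[OF S, of ws] by (simp add: distrib_left)
  qed (use one in simp)
  then show ?thesis using shortest_word[OF S g] by metis
qed

section \<open>Word metrics on finitely generated subgroups\<close>

lemma finite_generating_set_subset:
  "subgroup H G \<Longrightarrow> finite_generating_set G H T \<Longrightarrow> T \<subseteq> carrier G"
  using subgroup.subset unfolding finite_generating_set_def by blast

lemma quotient_in_generate:
  assumes "subgroup H G" "finite_generating_set G H T" "g \<in> H" "h \<in> H"
  shows "inv g \<otimes> h \<in> generate G T"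
  using assms subgroup.m_inv_closed subgroup.m_closed unfolding finite_generating_set_def by metis

lemma word_dist_refl: "g \<in> carrier G \<Longrightarrow> word_dist G T g g = 0"
  by (simp add: word_dist_def word_length_one)

lemma word_dist_nonneg: "0 \<le> word_dist G T g h"
  by (simp add: word_dist_def)

lemma word_dist_sym:
  assumes H: "subgroup H G" "finite_generating_set G H T" and gh: "g \<in> H" "h \<in> H"
  shows "word_dist G T g h = word_dist G T h g"
proof -
  have "g \<in> carrier G" "h \<in> carrier G" using gh subgroup.subset[OF H(1)] by auto
  then have "inv (inv g \<otimes> h) = inv h \<otimes> g" by (simp add: inv_mult_group)
  then show ?thesis
    using word_length_inv[OF finite_generating_set_subset[OF H] quotient_in_generate[OF H gh]]
    by (simp add: word_dist_def)
qed

lemma word_dist_triangle: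
  assumes H: "subgroup H G" "finite_generating_set G H T" and ghk: "g \<in> H" "h \<in> H" "k \<in> H"
  shows "word_dist G T g k \<le> word_dist G T g h + word_dist G T h k"
proof -
  have "g \<in> carrier G" "h \<in> carrier G" "k \<in> carrier G" using ghk subgroup.subset[OF H(1)] by auto
  then have "(inv g \<otimes> h) \<otimes> (inv h \<otimes> k) = inv g \<otimes> k"
    by (metis inv_closed m_assoc m_closed r_inv l_one)
  then have "word_length G T (inv g \<otimes> k) \<le> word_length G T (inv g \<otimes> h) + word_length G T (inv h \<otimes> k)"
    using word_length_mult_le[OF finite_generating_set_subset[OF H]
      quotient_in_generate[OF H ghk(1,2)] quotient_in_generate[OF H ghk(2,3)]] by simp
  then show ?thesis unfolding word_dist_def by linarith
qed

text \<open>Each letter of \<open>T\<close> has bounded length over \<open>S\<close>. This serves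
  both for the inclusion of a subgroup and for a change of generating set. In \<open>C\<close> the
  sum replaces a maximum, and the summand 1 secures \<open>1 \<le> C\<close> even for empty
  \<open>T\<close>.\<close>

lemma word_dist_lipschitz:
  assumes K: "subgroup K G" "finite_generating_set G K S"
    and H: "subgroup H G" "finite_generating_set G H T" and "H \<subseteq> K"
  obtains C where "1 \<le> C" "\<And>g h. g \<in> H \<Longrightarrow> h \<in> H \<Longrightarrow> word_dist G S g h \<le> C * word_dist G T g h"
proof -
  define C where "C = 1 + (\<Sum>t\<in>T. real (word_length G S t))"
  note S = finite_generating_set_subset[OF K] and T = finite_generating_set_subset[OF H]
  have fin: "finite T" using H(2) by (simp add: finite_generating_set_def)
  have gen: "g \<in> generate G S" if "g \<in> generate G T" for g
    using that assms unfolding finite_generating_set_def by auto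
  have TS: "t \<in> generate G S" if "t \<in> T" for t using gen generate.incl that by metis
  have t_le: "real (word_length G S t) \<le> C" if "t \<in> T" for t
    using member_le_sum[OF that, of "\<lambda>t. real (word_length G S t)"] fin by (simp add: C_def)
  have letter: "real (word_length G S s) \<le> C \<and> s \<in> generate G S" if "s \<in> T \<union> m_inv G ` T" for s
    using that t_le TS word_length_inv[OF S TS] generate_m_inv_closed[OF S TS] by auto
  have "real (word_length G S (s \<otimes> g)) \<le> C + real (word_length G S g)"
    if "s \<in> T \<union> m_inv G ` T" "g \<in> generate G T" for s g
  proof -
    have "word_length G S (s \<otimes> g) \<le> word_length G S s + word_length G S g"
      using letter[OF that(1)] gen[OF that(2)] by (intro word_length_mult_le[OF S]) auto
    then show ?thesis using letter[OF that(1)] by linarith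
  qed
  then have "real (word_length G S g) \<le> C * real (word_length G T g)" if "g \<in> generate G T" for g
    using that by (intro le_word_length[OF T]) (auto simp: word_length_one)
  then have "word_dist G S g h \<le> C * word_dist G T g h" if "g \<in> H" "h \<in> H" for g h
    unfolding word_dist_def using quotient_in_generate[OF H that] by blast
  moreover have "1 \<le> C" by (simp add: C_def sum_nonneg)
  ultimately show ?thesis using that by blast
qed

text \<open>The vertices are \<open>a\<close> times the prefixes of a shortest word for the quotient
  of \<open>a\<close> and \<open>b\<close>. Beyond \<open>n\<close> the prefix is the whole word, so
  all \<open>v i\<close> lie in \<open>H\<close>.\<close>

lemma word_geodesic:
  assumes H: "subgroup H G" "finite_generating_set G H T" and ab: "a \<in> H" "b \<in> H"
  obtains v :: "nat \<Rightarrow> 'a" and n where "v 0 = a" "v n = b" "\<And>i. v i \<in> H"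
    "\<And>i j. i \<le> n \<Longrightarrow> j \<le> n \<Longrightarrow> word_dist G T (v i) (v j) = \<bar>real i - real j\<bar>"
proof -
  note T = finite_generating_set_subset[OF H]
  obtain ws where ws: "length ws = word_length G T (inv a \<otimes> b)" "set ws \<subseteq> T \<union> m_inv G ` T"
    "foldr (\<otimes>) ws \<one> = inv a \<otimes> b"
    using shortest_word[OF T quotient_in_generate[OF H ab]] .
  define n where "n = length ws"
  have carr: "a \<in> carrier G" "b \<in> carrier G" using ab subgroup.subset[OF H(1)] by auto
  have wsc: "set ws \<subseteq> carrier G" using ws(2) letters_subset[OF T] by blast
  define x where "x i = foldr (\<otimes>) (take i ws) \<one>" for i
  have sub: "set (take i us) \<subseteq> set us" "set (drop i us) \<subseteq> set us" for i and us :: "'a list"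
    by (rule set_take_subset set_drop_subset)+
  have xc: "x i \<in> carrier G" for i unfolding x_def using wsc sub by (intro word_closed) blast
  have xH: "x i \<in> H" for i
    using word_in_generate[OF T, of "take i ws"] ws(2) sub(1)[of i ws] H(2)
    unfolding x_def finite_generating_set_def by blast
  define v where "v i = a \<otimes> x i" for i
  have vH: "v i \<in> H" for i unfolding v_def using ab xH subgroup.m_closed[OF H(1)] by blast
  have up: "word_dist G T (v i) (v j) \<le> real j - real i" if "i \<le> j" for i j
  proof -
    define y where "y = take (j - i) (drop i ws)"
    have y: "set y \<subseteq> T \<union> m_inv G ` T" "set y \<subseteq> carrier G"
      using ws(2) wsc sub unfolding y_def by (meson order_trans)+
    have "take j ws = take i ws @ y" using take_add[of i "j - i" ws] that by (simp add: y_def)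
    then have "x j = x i \<otimes> foldr (\<otimes>) y \<one>"
      using y(2) wsc sub(1)[of i ws] word_append[of "take i ws" y] by (simp add: x_def del: foldr_append)
    then have "v j = v i \<otimes> foldr (\<otimes>) y \<one>"
      using xc carr word_closed[OF y(2)] by (simp add: v_def m_assoc)
    then have "inv (v i) \<otimes> v j = foldr (\<otimes>) y \<one>"
      using word_closed[OF y(2)] xc carr by (simp add: v_def inv_solve_left')
    then have "word_dist G T (v i) (v j) \<le> real (length y)"
      using word_length_le[OF y(1)] by (simp add: word_dist_def)
    also have "\<dots> \<le> real j - real i" using that by (simp add: y_def)
    finally show ?thesis .
  qed
  have v0: "v 0 = a" and vn: "v n = b"
    using carr ws(3) by (simp_all add: v_def x_def n_def m_assoc[symmetric])
  have len: "word_dist G T a b = real n" by (simp add: word_dist_def n_def ws(1))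
  \<comment> \<open>Subwords give upper bounds; these add up to the distance \<open>n\<close> of the
    ends, so none of them can be strict.\<close>
  have eq: "word_dist G T (v i) (v j) = real j - real i" if "i \<le> j" "j \<le> n" for i j
    using up[of 0 i] up[of i j] up[of j n] that len v0 vn
      word_dist_triangle[OF H vH[of 0] vH[of i] vH[of n]]
      word_dist_triangle[OF H vH[of i] vH[of j] vH[of n]] by simp
  have "word_dist G T (v i) (v j) = \<bar>real i - real j\<bar>" if "i \<le> n" "j \<le> n" for i j
    using eq[of i j] eq[of j i] that word_dist_sym[OF H vH vH, of i j] by (cases "i \<le> j") auto
  then show ?thesis using that v0 vn vH by blast
qed

text \<open>The image of a discrete geodesic, extended as a step function. Rounding down changes
  parameter differences by at most 1, which the larger constant absorbs. This supplies the paths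
  inside the orbit that stability is compared with.\<close>

lemma qi_embedding_quasigeodesic:
  fixes f :: "'a \<Rightarrow> 'x::metric_space"
  assumes H: "subgroup H G" "finite_generating_set G H T"
    and f: "qi_embedding_with k l H (word_dist G T) UNIV dist f" and ab: "a \<in> H" "b \<in> H"
  shows "\<exists>q s t. quasigeodesic (k + l + 1) UNIV dist q s t (f a) (f b) \<and> q ` {s..t} \<subseteq> f ` H"
proof -
  obtain v n where v: "v 0 = a" "v n = b" "\<And>i. v i \<in> H"
    "\<And>i j. i \<le> n \<Longrightarrow> j \<le> n \<Longrightarrow> word_dist G T (v i) (v j) = \<bar>real i - real j\<bar>"
    by (rule word_geodesic[OF H ab]) blast
  have kl: "1 \<le> k" "0 \<le> l" and
    bounds: "\<And>g h. g \<in> H \<Longrightarrow> h \<in> H \<Longrightarrow> 1 / k * word_dist G T g h - l \<le> dist (f g) (f h)"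
      "\<And>g h. g \<in> H \<Longrightarrow> h \<in> H \<Longrightarrow> dist (f g) (f h) \<le> k * word_dist G T g h + l"
    using f by (auto simp: qi_embedding_with_def)
  define q where "q u = f (v (nat \<lfloor>u\<rfloor>))" for u :: real
  have "1 / (k + l + 1) * \<bar>u - w\<bar> - (k + l + 1) \<le> dist (q u) (q w) \<and>
      dist (q u) (q w) \<le> (k + l + 1) * \<bar>u - w\<bar> + (k + l + 1)"
    if uw: "u \<in> {0..real n}" "w \<in> {0..real n}" for u w
  proof
    define m where "m = \<bar>real (nat \<lfloor>u\<rfloor>) - real (nat \<lfloor>w\<rfloor>)\<bar>"
    have "nat \<lfloor>u\<rfloor> \<le> n" "nat \<lfloor>w\<rfloor> \<le> n" using uw by (auto simp: nat_le_iff floor_le_iff)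
    then have d: "word_dist G T (v (nat \<lfloor>u\<rfloor>)) (v (nat \<lfloor>w\<rfloor>)) = m" by (simp add: v(4) m_def)
    have m: "m \<le> \<bar>u - w\<bar> + 1" "\<bar>u - w\<bar> \<le> m + 1" "0 \<le> m"
      using uw unfolding m_def by (auto simp: abs_if) linarith+
    have "dist (q u) (q w) \<le> k * m + l"
      using bounds(2)[OF v(3) v(3)] d unfolding q_def by metis
    also have "k * m \<le> k * (\<bar>u - w\<bar> + 1)" using kl m by (intro mult_left_mono) auto
    also have "k * (\<bar>u - w\<bar> + 1) + l \<le> (k + l + 1) * \<bar>u - w\<bar> + (k + l + 1)"
      using kl by (simp add: algebra_simps)
    finally show "dist (q u) (q w) \<le> (k + l + 1) * \<bar>u - w\<bar> + (k + l + 1)" by simp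
    have "1 / (k + l + 1) * \<bar>u - w\<bar> \<le> 1 / k * (m + 1)"
      using kl m by (intro mult_mono) (auto simp: frac_le)
    also have "\<dots> \<le> 1 / k * m + 1" using kl by (simp add: field_simps)
    also have "1 / k * m \<le> dist (q u) (q w) + l"
      using bounds(1)[OF v(3) v(3), of "nat \<lfloor>u\<rfloor>" "nat \<lfloor>w\<rfloor>"] d unfolding q_def by simp
    finally show "1 / (k + l + 1) * \<bar>u - w\<bar> - (k + l + 1) \<le> dist (q u) (q w)" using kl by simp
  qed
  moreover have "q 0 = f a" "q (real n) = f b" by (simp_all add: q_def v)
  ultimately have "quasigeodesic (k + l + 1) UNIV dist q 0 (real n) (f a) (f b)"
    using kl by (auto simp: quasigeodesic_def qi_embedding_with_def dist_real_def)
  moreover have "q ` {0..real n} \<subseteq> f ` H" using v(3) by (auto simp: q_def)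
  ultimately show ?thesis by blast
qed

end

section \<open>Orbit maps\<close>

context
  fixes G :: "('g, 'r) monoid_scheme" and \<phi> :: "'g \<Rightarrow> 'x::metric_space \<Rightarrow> 'x"
  assumes G: "group G" and iso: "isometric_action G \<phi>"
begin

lemma action_mult: "g \<in> carrier G \<Longrightarrow> h \<in> carrier G \<Longrightarrow> \<phi> (g \<otimes>\<^bsub>G\<^esub> h) x = \<phi> g (\<phi> h x)"
  using iso group_action.composition_rule[of G UNIV \<phi> x g h] by (simp add: isometric_action_def)

lemma action_one: "\<phi> \<one>\<^bsub>G\<^esub> x = x"
  using iso group_action.id_eq_one[of G UNIV \<phi>] by (simp add: isometric_action_def fun_eq_iff restrict_def)

lemma action_isometry: "g \<in> carrier G \<Longrightarrow> dist (\<phi> g p) (\<phi> g q) = dist p q"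
  using iso by (simp add: isometric_action_def)

lemma dist_orbit:
  assumes "g \<in> carrier G" "h \<in> carrier G"
  shows "dist (\<phi> g x) (\<phi> h x) = dist x (\<phi> (inv\<^bsub>G\<^esub> g \<otimes>\<^bsub>G\<^esub> h) x)"
proof -
  interpret group G by (rule G)
  have "\<phi> h x = \<phi> g (\<phi> (inv\<^bsub>G\<^esub> g \<otimes>\<^bsub>G\<^esub> h) x)"
    using assms by (simp add: action_mult[symmetric] m_assoc[symmetric])
  then show ?thesis using action_isometry[OF assms(1)] by simp
qed

lemma orbit_map_lipschitz:
  assumes S: "finite_generating_set G (carrier G) S"
  obtains L where "0 < L"
    "\<And>g h. g \<in> carrier G \<Longrightarrow> h \<in> carrier G \<Longrightarrow> dist (\<phi> g x) (\<phi> h x) \<le> L * word_dist G S g h"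
proof -
  interpret group G by (rule G)
  note sub = finite_generating_set_subset[OF subgroup_self S]
  define L where "L = 1 + (\<Sum>s\<in>S. dist x (\<phi> s x))"
  have s_le: "dist x (\<phi> s x) \<le> L" if "s \<in> S" for s
    using member_le_sum[OF that, of "\<lambda>s. dist x (\<phi> s x)"] S
    by (simp add: L_def finite_generating_set_def)
  have "dist x (\<phi> (inv\<^bsub>G\<^esub> s) x) \<le> L" if "s \<in> S" for s
    using dist_orbit[of s "\<one>\<^bsub>G\<^esub>" x] s_le[OF that] that sub
    by (auto simp: action_one dist_commute)
  then have letter: "dist x (\<phi> s x) \<le> L" if "s \<in> S \<union> m_inv G ` S" for s
    using that s_le by auto
  have "dist x (\<phi> (s \<otimes>\<^bsub>G\<^esub> g) x) \<le> L + dist x (\<phi> g x)"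
    if s: "s \<in> S \<union> m_inv G ` S" and g: "g \<in> generate G S" for s g
  proof -
    have "s \<in> carrier G" "g \<in> carrier G"
      using s g sub letters_subset generate_in_carrier[OF sub] by auto
    then show ?thesis
      using dist_triangle[of x "\<phi> s (\<phi> g x)" "\<phi> s x"] letter[OF s]
      by (simp add: action_mult action_isometry)
  qed
  then have "dist x (\<phi> g x) \<le> L * real (word_length G S g)" if "g \<in> generate G S" for g
    using that by (intro le_word_length[OF sub]) (auto simp: action_one)
  then have "dist (\<phi> g x) (\<phi> h x) \<le> L * word_dist G S g h" if "g \<in> carrier G" "h \<in> carrier G" for g h
    using quotient_in_generate[OF subgroup_self S that] dist_orbit[OF that]
    by (simp add: word_dist_def)
  moreover have "0 < L" by (simp add: L_def add_pos_nonneg sum_nonneg)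
  ultimately show ?thesis using that by blast
qed

section \<open>Consequences of properness\<close>

context
  assumes proper: "proper_space TYPE('x)" "proper_action G \<phi>"
begin

text \<open>Such an element maps the centre of the compact ball of radius \<open>r\<close> around
  \<open>x\<close> back into that ball.\<close>

lemma finite_displacement: "finite {g \<in> carrier G. dist x (\<phi> g x) \<le> r}"
proof (cases "0 \<le> r")
  case True
  have "finite {g \<in> carrier G. \<phi> g ` cball x r \<inter> cball x r \<noteq> {}}"
    using proper by (simp add: proper_space_def proper_action_def)
  then show ?thesis
  proof (rule rev_finite_subset, intro subsetI)
    fix g assume g: "g \<in> {g \<in> carrier G. dist x (\<phi> g x) \<le> r}"
    then have "\<phi> g x \<in> \<phi> g ` cball x r \<inter> cball x r" using True by auto
    then show "g \<in> {g \<in> carrier G. \<phi> g ` cball x r \<inter> cball x r \<noteq> {}}" using g by blast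
  qed
next
  case False
  then have "{g \<in> carrier G. dist x (\<phi> g x) \<le> r} = {}" using zero_le_dist order_trans by blast
  then show ?thesis by (simp only: finite.emptyI)
qed

text \<open>By \<open>dist_orbit\<close> both distances depend only on the quotient of
  \<open>g\<close> and \<open>h\<close>, which ranges over a finite set; the sum of its word lengths
  serves as the bound.\<close>

lemma orbit_map_uniformly_proper:
  "\<exists>B. \<forall>g\<in>carrier G. \<forall>h\<in>carrier G. dist (\<phi> g x) (\<phi> h x) \<le> R \<longrightarrow> word_dist G S g h \<le> B"
proof -
  interpret group G by (rule G)
  define F where "F = {g \<in> carrier G. dist x (\<phi> g x) \<le> R}"
  have "real (word_length G S g) \<le> (\<Sum>g\<in>F. real (word_length G S g))" if "g \<in> F" for g
    using finite_displacement that unfolding F_def by (intro member_le_sum) auto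
  then show ?thesis
    by (intro exI[of _ "\<Sum>g\<in>F. real (word_length G S g)"])
      (auto simp: word_dist_def dist_orbit F_def)
qed

text \<open>Only finitely many elements of \<open>H\<close> bring \<open>x\<close> as close to
  \<open>p\<close> as a fixed \<open>h0\<close> does, so the infimum is a minimum over a finite
  set.\<close>

lemma nearest_orbit_point:
  assumes H: "H \<subseteq> carrier G" "H \<noteq> {}"
  shows "\<exists>h\<in>H. \<forall>h'\<in>H. dist p (\<phi> h x) \<le> dist p (\<phi> h' x)"
proof -
  obtain h0 where h0: "h0 \<in> H" using H by blast
  define N where "N = {h \<in> H. dist p (\<phi> h x) \<le> dist p (\<phi> h0 x)}"
  have "dist x (\<phi> h x) \<le> dist p x + dist p (\<phi> h0 x)" if "h \<in> N" for h
    using dist_triangle[of x "\<phi> h x" p] that by (simp add: N_def dist_commute)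
  then have "N \<subseteq> {g \<in> carrier G. dist x (\<phi> g x) \<le> dist p x + dist p (\<phi> h0 x)}"
    using H by (auto simp: N_def)
  then have "finite N" using finite_displacement by (rule finite_subset)
  moreover have "N \<noteq> {}" using h0 by (auto simp: N_def)
  ultimately obtain h where h: "is_arg_min (\<lambda>h. dist p (\<phi> h x)) (\<lambda>h. h \<in> N) h"
    using ex_is_arg_min_if_finite by metis
  then have "h \<in> H" "dist p (\<phi> h x) \<le> dist p (\<phi> h0 x)" by (auto simp: N_def is_arg_min_def)
  moreover have "dist p (\<phi> h x) \<le> dist p (\<phi> h' x)" if "h' \<in> H" for h'
    using h that calculation(2) by (cases "h' \<in> N") (auto simp: is_arg_min_linorder N_def)
  ultimately show ?thesis by blast
qed

end

end

section \<open>From the orbit map to stability of the subgroup\<close>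

theorem theorem1p1:
  fixes G :: "('g, 'r) monoid_scheme"
    and H :: "'g set"
    and \<phi> :: "'g \<Rightarrow> 'x::metric_space \<Rightarrow> 'x"
  assumes "group G"
    and "\<exists>S. finite_generating_set G (carrier G) S"
    and "proper_space TYPE('x)"
    and "geodesic_space TYPE('x)"
    and "isometric_action G \<phi>"
    and "proper_action G \<phi>"
    and "subgroup H G"
    and "\<exists>x T. finite_generating_set G H T \<and>
           stable_embedding H (word_dist G T) (UNIV :: 'x set) dist (\<lambda>g. \<phi> g x)"
  shows "stable_subgroup G H"
proof -
  interpret group G by (rule assms(1))
  note H = \<open>subgroup H G\<close>
  have HG: "H \<subseteq> carrier G" by (rule subgroup.subset[OF H])
  obtain x T0 where T0: "finite_generating_set G H T0" and
    emb: "stable_embedding H (word_dist G T0) (UNIV :: 'x set) dist (\<lambda>g. \<phi> g x)"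
    using assms(8) by blast
  define f where "f g = \<phi> g x" for g
  obtain k l where kl: "qi_embedding_with k l H (word_dist G T0) UNIV dist f"
    and stable: "stable_subspace (f ` H) dist UNIV dist"
    using emb unfolding stable_embedding_def qi_embedding_def f_def by blast
  have k: "1 \<le> k" "0 \<le> l" using kl by (auto simp: qi_embedding_with_def)
  have T0_le: "word_dist G T0 g h \<le> k * (dist (f g) (f h) + l)" if "g \<in> H" "h \<in> H" for g h
  proof -
    have "1 / k * word_dist G T0 g h - l \<le> dist (f g) (f h)"
      using kl that by (simp add: qi_embedding_with_def)
    then show ?thesis using k by (simp add: field_simps)
  qed
  have stable_subspace: "stable_subspace H (word_dist G T) (carrier G) (word_dist G S)"
    if S: "finite_generating_set G (carrier G) S" and T: "finite_generating_set G H T" for S T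
  proof -
    \<comment> \<open>The embedding is known for \<open>T0\<close> only, while \<open>S\<close> and
      \<open>T\<close> are arbitrary: \<open>C0\<close> and \<open>C2\<close> transfer bounds from
      \<open>T0\<close>, and \<open>C1\<close> bounds the inclusion.\<close>
    obtain C0 where C0: "1 \<le> C0" "\<And>g h. g \<in> H \<Longrightarrow> h \<in> H \<Longrightarrow> word_dist G S g h \<le> C0 * word_dist G T0 g h"
      using word_dist_lipschitz[OF subgroup_self S H T0 HG] by blast
    obtain C1 where C1: "1 \<le> C1" "\<And>g h. g \<in> H \<Longrightarrow> h \<in> H \<Longrightarrow> word_dist G S g h \<le> C1 * word_dist G T g h"
      using word_dist_lipschitz[OF subgroup_self S H T HG] by blast
    obtain C2 where C2: "1 \<le> C2" "\<And>g h. g \<in> H \<Longrightarrow> h \<in> H \<Longrightarrow> word_dist G T g h \<le> C2 * word_dist G T0 g h"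
      using word_dist_lipschitz[OF H T H T0] by blast
    obtain L where L: "0 < L"
      "\<And>g h. g \<in> carrier G \<Longrightarrow> h \<in> carrier G \<Longrightarrow> dist (f g) (f h) \<le> L * word_dist G S g h"
      using orbit_map_lipschitz[OF assms(1,5) S, of x] unfolding f_def by blast
    \<comment> \<open>On \<open>H\<close>, the distance over \<open>S\<close> is at most
      \<open>C0\<close> times that over \<open>T0\<close>, hence at most C0 k (dist + l) by
      \<open>T0_le\<close>.\<close>
    define A where "A = 1 + C0 * k * (1 + l)"
    have orbit: "proper_map_with_stable_image (carrier G) (word_dist G S) H f L A (k + l + 1)"
    proof
      show "\<exists>B. \<forall>g\<in>carrier G. \<forall>h\<in>carrier G. dist (f g) (f h) \<le> R \<longrightarrow> word_dist G S g h \<le> B" for R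
        unfolding f_def by (rule orbit_map_uniformly_proper[OF assms(1,5,3,6)])
      show "word_dist G S g h \<le> A * dist (f g) (f h) + A" if gh: "g \<in> H" "h \<in> H" for g h
      proof -
        have "word_dist G S g h \<le> C0 * (k * (dist (f g) (f h) + l))"
          using C0 T0_le[OF gh] gh by (meson mult_left_mono order_trans zero_le_one)
        also have "\<dots> = C0 * k * dist (f g) (f h) + C0 * k * l" by (simp add: algebra_simps)
        also have "\<dots> \<le> A * dist (f g) (f h) + A"
          using C0 k by (intro add_mono mult_right_mono) (auto simp: A_def algebra_simps)
        finally show ?thesis .
      qed
      show "\<exists>h\<in>H. \<forall>h'\<in>H. dist (f g) (f h) \<le> dist (f g) (f h')" for g
        unfolding f_def using subgroup.one_closed[OF H]
        by (intro nearest_orbit_point[OF assms(1,5,3,6) HG]) blast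
      show "\<exists>q s t. quasigeodesic (k + l + 1) UNIV dist q s t a b \<and> q ` {s..t} \<subseteq> f ` H"
        if "a \<in> f ` H" "b \<in> f ` H" for a b
      proof -
        obtain g h where "g \<in> H" "h \<in> H" "a = f g" "b = f h" using \<open>a \<in> f ` H\<close> \<open>b \<in> f ` H\<close> by blast
        then show ?thesis using qi_embedding_quasigeodesic[OF H T0 kl] by simp
      qed
      show "1 \<le> A" using C0 k by (simp add: A_def)
    qed (use L HG assms(4) stable word_dist_sym[OF subgroup_self S]
        word_dist_triangle[OF subgroup_self S] in \<open>auto simp: word_dist_nonneg word_dist_refl\<close>)
    have close: "\<forall>\<kappa>>1. \<exists>D>0. \<forall>a\<in>H. \<forall>b\<in>H. \<forall>q s t q' s' t'.
        quasigeodesic \<kappa> (carrier G) (word_dist G S) q s t a b \<longrightarrow>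
        quasigeodesic \<kappa> (carrier G) (word_dist G S) q' s' t' a b \<longrightarrow>
        hausdorff_close (word_dist G S) D (q ` {s..t}) (q' ` {s'..t'})"
      by (intro allI impI proper_map_with_stable_image.quasigeodesics_close[OF orbit])
    \<comment> \<open>\<open>C1\<close> serves the upper bound. The lower one passes from
      \<open>T\<close> to \<open>T0\<close>, then to the space by \<open>T0_le\<close>, then to
      \<open>S\<close> by the Lipschitz constant \<open>L\<close>, with slope C2 k L and error C2 k
      l.\<close>
    define c where "c = 1 + C1 + C2 * k * L"
    have c: "1 \<le> c" "C1 \<le> c" "C2 * k * L \<le> c" using C1 C2 k L by (auto simp: c_def)
    have l': "0 \<le> C2 * k * l" using C2 k by simp
    have "1 / c * word_dist G T g h - C2 * k * l \<le> word_dist G S g h \<and>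
        word_dist G S g h \<le> c * word_dist G T g h + C2 * k * l" if gh: "g \<in> H" "h \<in> H" for g h
    proof
      have "word_dist G T g h \<le> C2 * (k * (dist (f g) (f h) + l))"
        using C2 T0_le[OF gh] gh by (meson mult_left_mono order_trans zero_le_one)
      also have "\<dots> \<le> C2 * (k * (L * word_dist G S g h + l))"
        using C2 k L(2)[OF subsetD[OF HG gh(1)] subsetD[OF HG gh(2)]]
        by (intro mult_left_mono add_right_mono) auto
      also have "\<dots> = C2 * k * L * word_dist G S g h + C2 * k * l" by (simp add: algebra_simps)
      also have "\<dots> \<le> c * word_dist G S g h + c * (C2 * k * l)"
        using c l' mult_right_mono[OF c(1) l'] by (intro add_mono mult_right_mono) (auto simp: word_dist_nonneg)
      finally show "1 / c * word_dist G T g h - C2 * k * l \<le> word_dist G S g h"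
        using c by (simp add: field_simps)
      have "word_dist G S g h \<le> c * word_dist G T g h"
        using C1(2)[OF gh] mult_right_mono[OF c(2) word_dist_nonneg] by (rule order_trans)
      then show "word_dist G S g h \<le> c * word_dist G T g h + C2 * k * l" using l' by simp
    qed
    then have "qi_embedding H (word_dist G T) (carrier G) (word_dist G S) (\<lambda>y. y)"
      using c l' HG unfolding qi_embedding_def qi_embedding_with_def
      by (intro exI[of _ c] exI[of _ "C2 * k * l"]) auto
    then show ?thesis using close by (simp add: stable_subspace_def)
  qed
  show ?thesis
    unfolding stable_subgroup_def by (intro conjI allI impI H assms(2) exI[of _ T0] T0 stable_subspace)
qed

end
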